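(* Let $[\underline{H},\overline{H}]\subset(0,1)$ be a compact interval and let $\{H_j:j\in\mathbb{Z}_+\}$ be a sequence of Lipschitz functions $[0,1]\to[\underline{H},\overline{H}]$ for which there is a constant $C_0>0$ with $\nu_j\le C_0(1+j)$ for all $j\in\mathbb{Z}_+$. Let $X$ be the Gaussian Haar-based multifractional process built from $\{H_j\}$ and from independent standard Gaussian random variables $\varepsilon_{j,k}$. Then there is a finite constant $c>0$ such that for all $t',t''\in[0,1]$, $$\mathbb{E}\left(|X(t'')-X(t')|^2\right)\le c\,|t''-t'|^{2\underline{H}} .$$ Therefore (up to passing to a modification of $X$) the paths of $X$ are Hölder continuous functions on $[0,1]$ of any order strictly lower than $\underline{H}$.
   Context: $\mathbb{Z}_+$ is the set of non-negative integers. $(y)_+^\beta:=y^\beta$ if $y\ge 0$ and $(y)_+^\beta:=0$ otherwise. For a Lipschitz function $H_j$ on $[0,1]$, $\nu_j:=\sup_{x\in[0,1]}|H_j(x)|+\sup_{0\le x'<x''\le 1}\frac{|H_j(x'')-H_j(x')|}{x''-x'}$. The Haar mother wavelet is $h:=\mathbb{1}_{[0,1/2)}-\mathbb{1}_{[1/2,1)}$, and $h_{j,k}(s):=2^{j/2}h(2^js-k)$ for $j\in\mathbb{Z}_+$, $k\in\{0,\dots,2^j-1\}$, $s\in\mathbb{R}$. Let $\{\varepsilon_{j,k}: j\in\mathbb{Z}_+,\ k\in\{0,\dots,2^j-1\}\}$ be independent $\mathcal{N}(0,1)$ random variables on a probability space $(\Omega,\mathcal{F},\mathbb{P})$. The Gaussian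 Haar-based multifractional process (GHBMP) is $$X(t):=\sum_{j=0}^{+\infty}\sum_{k=0}^{2^j-1}\left(\int_0^1 (t-s)_+^{H_j(k/2^j)-1/2}h_{j,k}(s)\,ds\right)\varepsilon_{j,k},\qquad t\in[0,1],$$ where for each $t$ the series converges in $L_2(\Omega)$. *)

theory Defs
  imports "HOL-Probability.Probability"
begin

text \<open>At \<open>y = 0\<close> this is \<open>0\<close> for every exponent (\<open>0 powr \<beta> = 0\<close>, also for \<open>\<beta> \<le> 0\<close>); the function is only
  used inside an integral, where this single point does not matter.\<close>

definition pos_powr :: "real \<Rightarrow> real \<Rightarrow> real" where
  "pos_powr y \<beta> = (if y \<ge> 0 then y powr \<beta> else 0)"

definition haar :: "real \<Rightarrow> real" where
  "haar s = indicator {0..<1/2} s - indicator {1/2..<1} s"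

definition haar_wavelet :: "nat \<Rightarrow> nat \<Rightarrow> real \<Rightarrow> real" where
  "haar_wavelet j k s = 2 powr (real j / 2) * haar (2 ^ j * s - real k)"

text \<open>The suprema are taken in the reals, so this is meaningful only for \<open>f\<close> Lipschitz on \<open>[0,1]\<close>.\<close>

definition lipschitz_norm01 :: "(real \<Rightarrow> real) \<Rightarrow> real" where
  "lipschitz_norm01 f =
     (SUP x\<in>{0..1}. \<bar>f x\<bar>) +
     (SUP (x', x'')\<in>{(x', x''). 0 \<le> x' \<and> x' < x'' \<and> x'' \<le> 1}. \<bar>f x'' - f x'\<bar> / (x'' - x'))"

definition ghbmp_coeff :: "(nat \<Rightarrow> real \<Rightarrow> real) \<Rightarrow> real \<Rightarrow> nat \<Rightarrow> nat \<Rightarrow> real" where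
  "ghbmp_coeff H t j k =
     (LBINT s:{0..1}. pos_powr (t - s) (H j (real k / 2 ^ j) - 1/2) * haar_wavelet j k s)"

definition ghbmp_partial_sum ::
  "(nat \<Rightarrow> real \<Rightarrow> real) \<Rightarrow> (nat \<Rightarrow> nat \<Rightarrow> 'a \<Rightarrow> real) \<Rightarrow> nat \<Rightarrow> real \<Rightarrow> 'a \<Rightarrow> real" where
  "ghbmp_partial_sum H \<epsilon> J t \<omega> = (\<Sum>j<J. \<Sum>k<2 ^ j. ghbmp_coeff H t j k * \<epsilon> j k \<omega>)"

definition square_integrable :: "'a measure \<Rightarrow> ('a \<Rightarrow> real) \<Rightarrow> bool" where
  "square_integrable M f \<longleftrightarrow> f \<in> borel_measurable M \<and> integrable M (\<lambda>\<omega>. (f \<omega>)\<^sup>2)"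

definition tendsto_L2 :: "'a measure \<Rightarrow> (nat \<Rightarrow> 'a \<Rightarrow> real) \<Rightarrow> ('a \<Rightarrow> real) \<Rightarrow> bool" where
  "tendsto_L2 M S f \<longleftrightarrow>
     (\<forall>n. square_integrable M (S n)) \<and> square_integrable M f \<and>
     (\<lambda>n. \<integral>\<omega>. (S n \<omega> - f \<omega>)\<^sup>2 \<partial>M) \<longlonglongrightarrow> 0"

definition standard_gaussian_family :: "'a measure \<Rightarrow> (nat \<Rightarrow> nat \<Rightarrow> 'a \<Rightarrow> real) \<Rightarrow> bool" where
  "standard_gaussian_family M \<epsilon> \<longleftrightarrow>
     prob_space.indep_vars M (\<lambda>_. borel) (\<lambda>(j, k). \<epsilon> j k) {(j, k). k < 2 ^ j} \<and>
     (\<forall>j. \<forall>k<2 ^ j. distributed M lborel (\<epsilon> j k) std_normal_density)"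

text \<open>An \<open>L\<^sub>2\<close>-limit is determined only up to null sets, so this is a predicate, satisfied by
  every choice of representatives of the \<open>X t\<close>.\<close>

definition GHBMP ::
  "'a measure \<Rightarrow> (nat \<Rightarrow> real \<Rightarrow> real) \<Rightarrow> (nat \<Rightarrow> nat \<Rightarrow> 'a \<Rightarrow> real) \<Rightarrow> (real \<Rightarrow> 'a \<Rightarrow> real) \<Rightarrow> bool" where
  "GHBMP M H \<epsilon> X \<longleftrightarrow>
     (\<forall>t\<in>{0..1}. tendsto_L2 M (\<lambda>J. ghbmp_partial_sum H \<epsilon> J t) (X t))"

definition modification_on ::
  "real set \<Rightarrow> 'a measure \<Rightarrow> (real \<Rightarrow> 'a \<Rightarrow> real) \<Rightarrow> (real \<Rightarrow> 'a \<Rightarrow> real) \<Rightarrow> bool" where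
  "modification_on T M X Y \<longleftrightarrow>
     (\<forall>t\<in>T. Y t \<in> borel_measurable M \<and> (AE \<omega> in M. Y t \<omega> = X t \<omega>))"

definition holder_on :: "real \<Rightarrow> real set \<Rightarrow> (real \<Rightarrow> real) \<Rightarrow> bool" where
  "holder_on \<gamma> T f \<longleftrightarrow> (\<exists>C. \<forall>s\<in>T. \<forall>t\<in>T. \<bar>f t - f s\<bar> \<le> C * \<bar>t - s\<bar> powr \<gamma>)"

end

theory Submission
  imports Defs
begin

text \<open>Scaling turns the coefficient of index \<open>(j, k)\<close> into \<open>2 powr (- j a) / b * \<psi>\<^sub>b (2 ^ j t - k)\<close> with
  \<open>a = H\<^sub>j (k / 2 ^ j)\<close>, \<open>b = a + 1/2\<close> and \<open>\<psi>\<^sub>b\<close> a second difference of \<open>x\<^sub>+ powr b\<close>. The profile \<open>\<psi>\<^sub>b\<close>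
  decays like \<open>x powr (b - 2)\<close>, which is square summable because \<open>a < 1\<close>, and its increments over a
  distance \<open>d \<le> 1\<close> are bounded by \<open>d powr min b 1\<close> times such a decaying weight. With
  \<open>\<delta> = \<bar>t'' - t'\<bar>\<close>, level \<open>j\<close> therefore contributes to the variance of the increment at most a
  constant times \<open>\<delta> powr (2 Hlow)\<close> times \<open>min (2 ^ j \<delta>) (1 / (2 ^ j \<delta>)) powr \<tau>\<close> for some \<open>\<tau> > 0\<close>,
  and the geometric sum over \<open>j\<close> is bounded uniformly in \<open>\<delta>\<close>.
  The partial sums are Gaussian, hence all even moments of their increments
  are controlled by the variance; Markov's inequality carries the resulting tail bounds over to the
  \<open>L\<^sub>2\<close>-limit, and the Kolmogorov--Chentsov argument on dyadic points gives the modification.\<close>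

section \<open>The Haar coefficients\<close>

lemma pos_powr_eq: "pos_powr y b = max y 0 powr b"
  by (auto simp: pos_powr_def max_def)

text \<open>Subadditivity of a concave power, obtained without derivatives: for
  \<open>s = x + d\<close> the factor \<open>s powr (b - 1)\<close> is at most
  \<open>y powr (b - 1)\<close> whenever \<open>0 < y \<le> s\<close>, so \<open>s powr b\<close>
  splits into two pieces, each bounded by its own power.\<close>

lemma powr_add_le_real:
  fixes x d b :: real
  assumes "0 \<le> x" "0 \<le> d" "0 < b" "b \<le> 1"
  shows "(x + d) powr b \<le> x powr b + d powr b"
proof (cases "x + d = 0")
  case True
  then show ?thesis using assms by (auto simp: add_nonneg_eq_0_iff)
next
  case False
  define s where "s = x + d"
  have s: "s > 0" using False assms by (auto simp: s_def)
  have *: "y * s powr (b - 1) \<le> y powr b" if "0 \<le> y" "y \<le> s" for y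
  proof (cases "y = 0")
    case False
    then have "y * s powr (b - 1) \<le> y * y powr (b - 1)"
      using that assms by (intro mult_left_mono powr_mono2') auto
    also have "\<dots> = y powr b" using False that by (simp add: powr_mult_base)
    finally show ?thesis .
  qed simp
  have "s powr b = s * s powr (b - 1)" using s by (simp add: powr_mult_base)
  also have "\<dots> = x * s powr (b - 1) + d * s powr (b - 1)" by (simp add: s_def algebra_simps)
  also have "\<dots> \<le> x powr b + d powr b" using assms by (intro add_mono *) (auto simp: s_def)
  finally show ?thesis by (simp add: s_def)
qed

lemma pos_powr_mono: "0 \<le> b \<Longrightarrow> x \<le> y \<Longrightarrow> pos_powr x b \<le> pos_powr y b"
  unfolding pos_powr_eq by (intro powr_mono2) auto

lemma powr_le_two: assumes "x \<le> 3" "0 \<le> x" "0 \<le> q" "q \<le> 1/2" shows "x powr q \<le> (2::real)"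
proof -
  have "x powr q \<le> 4 powr q" using assms by (intro powr_mono2) auto
  also have "\<dots> \<le> 4 powr (1/2)" using assms by (intro powr_mono) auto
  also have "\<dots> = 2" by (simp add: powr_half_sqrt)
  finally show ?thesis .
qed

text \<open>Truncation at \<open>0\<close> does not increase distances, which reduces the claim to
  nonnegative \<open>u \<le> v\<close>. For \<open>b \<le> 1\<close> subadditivity suffices; for
  \<open>b > 1\<close> the mean value theorem gives a slope of at most \<open>(3/2) * 2\<close>,
  since the intermediate point stays below \<open>3\<close>.\<close>

lemma pos_powr_diff_le:
  assumes "y \<le> z" "z \<le> 3" "z - y \<le> 1" "1/2 < b" "b < 3/2"
  shows "\<bar>pos_powr z b - pos_powr y b\<bar> \<le> 3 * (z - y) powr min b 1"
proof -
  define u v where "u = max y 0" and "v = max z 0"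
  have uv: "0 \<le> u" "u \<le> v" "v \<le> 3" "v - u \<le> z - y" using assms by (auto simp: u_def v_def)
  have "v powr b - u powr b \<le> 3 * (v - u) powr min b 1"
  proof (cases "b \<le> 1")
    case True
    have "v powr b = (u + (v - u)) powr b" by simp
    also have "\<dots> \<le> u powr b + (v - u) powr b"
      using uv assms True by (intro powr_add_le_real) auto
    also have "\<dots> \<le> u powr b + 3 * (v - u) powr b" by simp
    finally show ?thesis using True by simp
  next
    case False
    show ?thesis
    proof (cases "u = v")
      case False
      then have "u < v" using uv by simp
      obtain w where w: "u < w" "w < v" "v powr b - u powr b = (b * w powr (b - 1)) * (v - u)"
      proof (rule mvt[where f = "\<lambda>x. x powr b" and f' = "\<lambda>w. (*) (b * w powr (b - 1))"])
        show "continuous_on {u..v} (\<lambda>x. x powr b)"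
          using uv assms by (intro continuous_on_powr') (auto intro: continuous_intros)
        show "((\<lambda>x. x powr b) has_derivative (*) (b * x powr (b - 1))) (at x)" if "u < x" for x
          using has_real_derivative_powr[of x b] that uv by (simp add: has_field_derivative_def)
      qed (use \<open>u < v\<close> in auto)
      have "w powr (b - 1) \<le> 2" using w uv assms \<open>\<not> b \<le> 1\<close> by (intro powr_le_two) auto
      then have "b * w powr (b - 1) \<le> (3/2) * 2" using assms by (intro mult_mono) auto
      then have "(v - u) * (b * w powr (b - 1)) \<le> (v - u) * 3"
        using uv by (intro mult_left_mono) auto
      then show ?thesis using \<open>\<not> b \<le> 1\<close> w uv by (simp add: min_def mult.commute)
    qed simp
  qed
  also have "\<dots> \<le> 3 * (z - y) powr min b 1"
    using uv assms by (intro mult_left_mono powr_mono2) auto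
  finally show ?thesis
    using pos_powr_mono[of b y z] assms by (simp add: pos_powr_eq u_def v_def)
qed

section \<open>Decay and increments of the Haar profile\<close>

text \<open>For \<open>b > 0\<close>, \<open>haar_profile b x / b\<close> is the integral of
  \<open>pos_powr (x - s) (b - 1)\<close> against \<open>haar s\<close>: up to a Gamma factor, the
  fractional integral of order \<open>b\<close> of the mother wavelet.\<close>

definition haar_profile :: "real \<Rightarrow> real \<Rightarrow> real" where
  "haar_profile b x = pos_powr x b - 2 * pos_powr (x - 1/2) b + pos_powr (x - 1) b"

lemma haar_profile_eq_0: "x \<le> 0 \<Longrightarrow> haar_profile b x = 0"
  by (simp add: haar_profile_def pos_powr_eq)

text \<open>The mean value theorem is applied twice with step \<open>1/2\<close>, first to a
  difference of powers and then to its derivative; each application contributes a factor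
  \<open>1/2\<close>, whence the \<open>4\<close>. The final point exceeds \<open>x - 1\<close>, and
  \<open>q \<le> 2\<close> makes the remaining power nonincreasing.\<close>

lemma second_difference_powr_le:
  fixes x q :: real
  assumes "1 < x" "q \<le> 2"
  shows "\<bar>x powr q - 2 * (x - 1/2) powr q + (x - 1) powr q\<bar> \<le> \<bar>q * (q - 1)\<bar> / 4 * (x - 1) powr (q - 2)"
proof -
  have "\<exists>w>x - 1/2. w < x \<and> (x powr q - (x - 1/2) powr q) - ((x - 1/2) powr q - (x - 1/2 - 1/2) powr q) =
     (x - (x - 1/2)) * (q * w powr (q - 1) - q * (w - 1/2) powr (q - 1))"
    using assms by (intro MVT2) (auto intro!: derivative_eq_intros)
  then obtain w where w: "x - 1/2 < w" "w < x"
    "(x powr q - (x - 1/2) powr q) - ((x - 1/2) powr q - (x - 1/2 - 1/2) powr q) =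
     (x - (x - 1/2)) * (q * w powr (q - 1) - q * (w - 1/2) powr (q - 1))" by blast
  have "\<exists>v>w - 1/2. v < w \<and> q * w powr (q - 1) - q * (w - 1/2) powr (q - 1) =
     (w - (w - 1/2)) * (q * ((q - 1) * v powr (q - 1 - 1)))"
    using assms w by (intro MVT2) (auto intro!: derivative_eq_intros)
  then obtain v where v: "w - 1/2 < v" "v < w" "q * w powr (q - 1) - q * (w - 1/2) powr (q - 1) =
     (w - (w - 1/2)) * (q * ((q - 1) * v powr (q - 1 - 1)))" by blast
  have "x powr q - 2 * (x - 1/2) powr q + (x - 1) powr q = (q * (q - 1)) / 4 * v powr (q - 2)"
    using w(3) v(3) by (simp add: algebra_simps)
  then have "\<bar>x powr q - 2 * (x - 1/2) powr q + (x - 1) powr q\<bar> = \<bar>q * (q - 1)\<bar> / 4 * v powr (q - 2)"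
    by (simp only: abs_mult abs_divide) simp
  also have "\<dots> \<le> \<bar>q * (q - 1)\<bar> / 4 * (x - 1) powr (q - 2)"
    using assms v w by (intro mult_left_mono powr_mono2') auto
  finally show ?thesis .
qed

text \<open>On a bounded range the decay weight is at least \<open>4 powr (-(3/2))\<close>, so there
  a constant estimate already has the required decaying form.\<close>

lemma powr_ge_eighth:
  fixes z p :: real
  assumes "0 \<le> z" "z \<le> 3" "p \<le> 3/2" "0 \<le> p"
  shows "1 / 8 \<le> (1 + z) powr (- p)"
proof -
  have "1 / 8 = (4::real) powr (-(3/2))"
  proof -
    have "(4::real) powr (-(3/2)) = (2 powr 2) powr (-(3/2))" by simp
    also have "\<dots> = 2 powr (-3)" unfolding powr_powr by simp
    finally show ?thesis by (simp add: powr_minus divide_simps)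
  qed
  also have "\<dots> \<le> 4 powr (- p)" using assms by (intro powr_mono) auto
  also have "\<dots> \<le> (1 + z) powr (- p)" using assms by (intro powr_mono2') auto
  finally show ?thesis .
qed

text \<open>Transfers decay from a comparable point \<open>r\<close> to \<open>1 + z\<close>. The
  range of \<open>q\<close> covers the exponents \<open>b - 2\<close> and \<open>b - 3\<close> for
  \<open>b > 1/2\<close>, and \<open>32 = 4 powr (5/2)\<close> is the worst loss.\<close>

lemma powr_scale_le:
  fixes r :: real
  assumes "r \<ge> (1 + z) / 4" "0 \<le> z" "0 \<le> p" "p \<le> - q" "q \<ge> -5/2"
  shows "r powr q \<le> 32 * (1 + z) powr (- p)"
proof -
  have "r powr q \<le> ((1 + z) / 4) powr q" using assms by (intro powr_mono2') auto
  also have "\<dots> = 4 powr (- q) * (1 + z) powr q"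
    using assms by (simp add: powr_divide powr_minus divide_simps)
  also have "\<dots> \<le> 4 powr (5/2) * (1 + z) powr (-p)"
    using assms by (intro mult_mono powr_mono) auto
  also have "(4::real) powr (5/2) = (2 powr 2) powr (5/2)" by simp
  also have "\<dots> = 32" unfolding powr_powr by simp
  finally show ?thesis .
qed

text \<open>Near the kinks, where \<open>y \<le> 2\<close> and hence \<open>z \<le> 3\<close>, the
  three truncated powers are estimated separately, which gives
  \<open>96 = 3 * (1 + 2 + 1) * 8\<close>. Beyond them the mean value theorem applies: the
  derivative is \<open>b\<close> times a second difference of exponent \<open>b - 1\<close>, so it
  decays with exponent \<open>b - 3\<close>.\<close>

lemma haar_profile_diff_le:
  assumes b: "1/2 < b" "b < 3/2" and p: "0 \<le> p" "p \<le> 2 - b" and yz: "y \<le> z" "z - y \<le> 1" "0 \<le> z"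
  shows "\<bar>haar_profile b z - haar_profile b y\<bar> \<le> 96 * ((z - y) powr min b 1 * (1 + z) powr (- p))"
proof (cases "y \<le> 2")
  case True
  have *: "\<bar>pos_powr (z - e) b - pos_powr (y - e) b\<bar> \<le> 3 * (z - y) powr min b 1" if "0 \<le> e" for e
    using pos_powr_diff_le[of "y - e" "z - e" b] that yz b True by simp
  have "\<bar>haar_profile b z - haar_profile b y\<bar> \<le> 12 * (z - y) powr min b 1"
    using *[of 0] *[of "1/2"] *[of 1] unfolding haar_profile_def by simp
  also have "\<dots> \<le> 12 * ((z - y) powr min b 1 * (8 * (1 + z) powr (- p)))"
  proof -
    have "1 \<le> 8 * (1 + z) powr (- p)" using powr_ge_eighth[of z p] yz True b p by simp
    from mult_left_mono[OF this, of "12 * (z - y) powr min b 1"] show ?thesis by (simp add: mult_ac)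
  qed
  finally show ?thesis by simp
next
  case False
  show ?thesis
  proof (cases "y = z")
    case False
    have eq: "haar_profile b x = x powr b - 2 * (x - 1/2) powr b + (x - 1) powr b" if "x > 1" for x
      using that by (simp add: haar_profile_def pos_powr_def)
    define D where "D x = b * (x powr (b-1) - 2 * (x - 1/2) powr (b-1) + (x - 1) powr (b-1))" for x
    have "\<exists>w>y. w < z \<and> haar_profile b z - haar_profile b y = (z - y) * D w"
    proof -
      have "\<exists>w>y. w < z \<and> (z powr b - 2 * (z - 1/2) powr b + (z - 1) powr b) - 
         (y powr b - 2 * (y - 1/2) powr b + (y - 1) powr b) = (z - y) * D w"
        using yz False \<open>\<not> y \<le> 2\<close>
        by (intro MVT2) (auto intro!: derivative_eq_intros simp: D_def algebra_simps)
      then show ?thesis using yz False \<open>\<not> y \<le> 2\<close> by (simp add: eq)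
    qed
    then obtain w where w: "y < w" "w < z" "haar_profile b z - haar_profile b y = (z - y) * D w" by blast
    have "\<bar>w powr (b-1) - 2 * (w - 1/2) powr (b-1) + (w - 1) powr (b-1)\<bar>
      \<le> \<bar>(b-1) * (b-1-1)\<bar> / 4 * (w - 1) powr (b - 1 - 2)"
      using w False \<open>\<not> y \<le> 2\<close> b by (intro second_difference_powr_le) auto
    also have "\<dots> \<le> 1 * (32 * (1 + z) powr (- p))"
    proof (intro mult_mono)
      have "\<bar>b - 1\<bar> * \<bar>b-1-1\<bar> \<le> (1/2) * (3/2)"
        using b by (intro mult_mono) (auto simp: abs_if)
      then show "\<bar>(b-1) * (b-1-1)\<bar> / 4 \<le> 1" by (simp add: abs_mult)
      \<comment> \<open>From \<open>w > y\<close>, \<open>y > 2\<close> and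
        \<open>z \<le> y + 1\<close> follows \<open>w - 1 \<ge> (1 + z) / 4\<close>.\<close>
      show "(w - 1) powr (b - 1 - 2) \<le> 32 * (1 + z) powr (- p)"
        using w yz \<open>\<not> y \<le> 2\<close> b p by (intro powr_scale_le) auto
    qed auto
    finally have "\<bar>D w\<bar> \<le> (3/2) * (32 * (1 + z) powr (- p))"
      unfolding D_def abs_mult using b by (intro mult_mono) auto
    then have D: "\<bar>D w\<bar> \<le> 96 * (1 + z) powr (- p)"
      by (rule order_trans) simp
    have "z - y \<le> (z - y) powr min b 1"
    proof -
      have "(z - y) powr 1 \<le> (z - y) powr min b 1" using yz by (intro powr_mono') auto
      then show ?thesis using yz by simp
    qed
    then have "(z - y) * \<bar>D w\<bar> \<le> (z - y) powr min b 1 * (96 * (1 + z) powr (- p))"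
      using D yz by (intro mult_mono) auto
    then show ?thesis using w yz by (simp add: abs_mult)
  qed simp
qed

text \<open>Each of the three powers grows; only the cancellation in their second difference
  produces decay, with exponent \<open>b - 2\<close>. For \<open>z \<le> 2\<close> the crude bound
  \<open>3\<close> for each power and the lower bound of the weight suffice.\<close>

lemma haar_profile_le:
  assumes b: "1/2 < b" "b < 3/2" and p: "0 \<le> p" "p \<le> 2 - b" and z: "0 \<le> z"
  shows "\<bar>haar_profile b z\<bar> \<le> 96 * (1 + z) powr (- p)"
proof (cases "z \<le> 2")
  case True
  have *: "0 \<le> pos_powr (z - e) b \<and> pos_powr (z - e) b \<le> 3" if "0 \<le> e" for e
  proof -
    have "pos_powr (z - e) b \<le> pos_powr 2 b" using that True b by (intro pos_powr_mono) auto
    also have "\<dots> = 2 powr b" by (simp add: pos_powr_def)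
    also have "\<dots> \<le> 2 powr (3/2)" using b by (intro powr_mono) auto
    also have "\<dots> \<le> 3"
    proof -
      have "(2 powr (3/2))^2 = (2::real) powr 3"
        by (simp add: powr_powr flip: powr_realpow)
      then have "(2 powr (3/2))^2 \<le> (3::real)^2" by simp
      then show ?thesis by (rule power2_le_imp_le) simp
    qed
    finally show ?thesis by (simp add: pos_powr_eq)
  qed
  have "\<bar>haar_profile b z\<bar> \<le> 12"
    using *[of 0] *[of "1/2"] *[of 1] unfolding haar_profile_def abs_le_iff by simp
  also have "12 \<le> 96 * (1 + z) powr (- p)"
    using powr_ge_eighth[of z p] z True b p by simp
  finally show ?thesis .
next
  case False
  have "\<bar>haar_profile b z\<bar> = \<bar>z powr b - 2 * (z - 1/2) powr b + (z - 1) powr b\<bar>"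
    using False by (simp add: haar_profile_def pos_powr_def)
  also have "\<dots> \<le> \<bar>b * (b-1)\<bar> / 4 * (z - 1) powr (b - 2)"
    using False b by (intro second_difference_powr_le) auto
  also have "\<dots> \<le> 1 * (32 * (1 + z) powr (- p))"
  proof (intro mult_mono)
    have "\<bar>b\<bar> * \<bar>b-1\<bar> \<le> (3/2) * (1/2)"
      using b by (intro mult_mono) (auto simp: abs_if)
    then show "\<bar>b * (b-1)\<bar> / 4 \<le> 1" by (simp add: abs_mult)
    show "(z - 1) powr (b - 2) \<le> 32 * (1 + z) powr (- p)"
      using z False b p by (intro powr_scale_le) auto
  qed auto
  also have "\<dots> \<le> 96 * (1 + z) powr (- p)" by simp
  finally show ?thesis .
qed

section \<open>Closed form of the coefficients\<close>

text \<open>The antiderivative \<open>- pos_powr (t - s) b / b\<close> is continuous because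
  \<open>b > 0\<close>, but it need not be differentiable at \<open>s = t\<close>, where the
  integrand is unbounded if \<open>b < 1\<close>; hence the fundamental theorem with exceptional set
  \<open>{t}\<close>. Nonnegativity of the integrand turns the gauge integral into a Lebesgue
  integral.\<close>

lemma integral_pos_powr:
  assumes b: "0 < b" and pq: "p \<le> q"
  shows "has_bochner_integral lborel (\<lambda>s. indicator {p..<q} s * pos_powr (t - s) (b - 1))
           ((pos_powr (t - p) b - pos_powr (t - q) b) / b)"
proof (rule has_bochner_integral_nn_integral)
  let ?f = "\<lambda>s. indicator {p..<q} s * pos_powr (t - s) (b - 1)"
  show meas: "?f \<in> borel_measurable lborel" unfolding pos_powr_eq by measurable
  show "AE x in lborel. 0 \<le> ?f x" by (simp add: pos_powr_eq)
  show "0 \<le> (pos_powr (t - p) b - pos_powr (t - q) b) / b"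
    using b pos_powr_mono[of b "t - q" "t - p"] pq by simp
  have "((\<lambda>s. pos_powr (t - s) (b - 1)) has_integral
       (- pos_powr (t - q) b / b - (- pos_powr (t - p) b / b))) {p..q}"
  proof (rule fundamental_theorem_of_calculus_interior_strong[of "{t}"])
    show "continuous_on {p..q} (\<lambda>s. - pos_powr (t - s) b / b)"
      unfolding pos_powr_eq using b by (intro continuous_intros continuous_on_powr') auto
    fix s assume s: "s \<in> {p<..<q} - {t}"
    show "((\<lambda>s. - pos_powr (t - s) b / b) has_vector_derivative pos_powr (t - s) (b - 1)) (at s)"
    proof (cases "s < t")
      case True
      have "((\<lambda>s. - ((t - s) powr b) / b) has_real_derivative pos_powr (t - s) (b - 1)) (at s)"
        using True b by (auto intro!: derivative_eq_intros simp: pos_powr_def)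
      moreover have "\<forall>\<^sub>F s in nhds s. - pos_powr (t - s) b / b = - ((t - s) powr b) / b"
        by (rule eventually_mono[OF eventually_nhds_in_open[of "{..<t}"]]) (use True in \<open>auto simp: pos_powr_def\<close>)
      ultimately have "((\<lambda>s. - pos_powr (t - s) b / b) has_real_derivative pos_powr (t - s) (b - 1)) (at s)"
        by (subst DERIV_cong_ev[OF refl _ refl])
      then show ?thesis by (simp only: has_real_derivative_iff_has_vector_derivative)
    next
      case False
      have "eventually (\<lambda>s. - pos_powr (t - s) b / b = 0) (nhds s)"
        by (rule eventually_mono[OF eventually_nhds_in_open[of "{t<..}"]]) (use s False in \<open>auto simp: pos_powr_def\<close>)
      then have "((\<lambda>s. - pos_powr (t - s) b / b) has_real_derivative 0) (at s)"
        by (subst DERIV_cong_ev[OF refl _ refl, where g = "\<lambda>_. 0"]) simp_all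
      then show ?thesis
        using s False by (simp add: pos_powr_def flip: has_real_derivative_iff_has_vector_derivative)
    qed
  qed (use pq in auto)
  then have "((\<lambda>s. pos_powr (t - s) (b - 1)) has_integral
       (pos_powr (t - p) b - pos_powr (t - q) b) / b) {p..q}"
    by (simp add: diff_divide_distrib)
  then have "((\<lambda>s. if s \<in> {p..q} then pos_powr (t - s) (b - 1) else 0) has_integral
       (pos_powr (t - p) b - pos_powr (t - q) b) / b) UNIV"
    by (simp only: has_integral_restrict_UNIV)
  \<comment> \<open>The right endpoint \<open>q\<close> is a null set, so the half-open interval may
    replace the closed one.\<close>
  then have "(?f has_integral (pos_powr (t - p) b - pos_powr (t - q) b) / b) UNIV"
    by (rule has_integral_spike[of "{q}", rotated 2]) (auto simp: indicator_def)
  then show "(\<integral>\<^sup>+x. ennreal (?f x) \<partial>lborel) = ennreal ((pos_powr (t - p) b - pos_powr (t - q) b) / b)"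
    by (intro nn_integral_has_integral_lborel) (use meas in \<open>auto simp: pos_powr_eq\<close>)
qed

lemma haar_scaled_eq:
  "haar (2 ^ j * s - real k) =
     indicator {real k / 2 ^ j..<(real k + 1/2) / 2 ^ j} s - indicator {(real k + 1/2) / 2 ^ j..<(real k + 1) / 2 ^ j} s"
proof -
  have "2 ^ j * s - real k \<in> {0..<1/2} \<longleftrightarrow> s \<in> {real k / 2 ^ j..<(real k + 1/2) / 2 ^ j}"
    "2 ^ j * s - real k \<in> {1/2..<1} \<longleftrightarrow> s \<in> {(real k + 1/2) / 2 ^ j..<(real k + 1) / 2 ^ j}"
    by (auto simp: pos_divide_le_eq pos_less_divide_eq mult.commute[of s])
  then show ?thesis by (simp add: haar_def indicator_def)
qed

lemma pos_powr_mult: "0 < c \<Longrightarrow> pos_powr (c * x) b = c powr b * pos_powr x b"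
  by (auto simp: pos_powr_def powr_mult zero_le_mult_iff)

lemma ghbmp_coeff_eq:
  assumes k: "k < 2 ^ j" and a: "a = H j (real k / 2 ^ j)" "0 < a"
  shows "ghbmp_coeff H t j k = 2 powr (- real j * a) / (a + 1/2) * haar_profile (a + 1/2) (2 ^ j * t - real k)"
proof -
  define b where "b = a + 1/2"
  define u m v where "u = real k / 2 ^ j" "m = (real k + 1/2) / 2 ^ j" "v = (real k + 1) / 2 ^ j"
  note uv = this
  have b: "b > 0" using a b_def by simp
  have le: "u \<le> m" "m \<le> v" "0 \<le> u" by (auto simp: uv divide_right_mono)
  \<comment> \<open>The support \<open>{u..<v}\<close> of the wavelet therefore lies in
    \<open>{0..1}\<close>, and restricting the integral to \<open>{0..1}\<close> cuts nothing
    off.\<close>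
  have "real k + 1 \<le> 2 ^ j"
    using k by (metis Suc_leI of_nat_Suc of_nat_le_iff of_nat_numeral of_nat_power add.commute)
  then have v1: "v \<le> 1" by (simp add: uv)
  have eq: "indicator {0..1} s *\<^sub>R (pos_powr (t - s) (a - 1/2) * haar_wavelet j k s) =
     2 powr (real j / 2) * (indicator {u..<m} s * pos_powr (t - s) (b - 1) - indicator {m..<v} s * pos_powr (t - s) (b - 1))" for s
    unfolding haar_wavelet_def haar_scaled_eq uv[symmetric] b_def
    using le v1 by (auto simp: indicator_def)
  have "has_bochner_integral lborel (\<lambda>s. indicator {0..1} s *\<^sub>R (pos_powr (t - s) (a - 1/2) * haar_wavelet j k s))
     (2 powr (real j / 2) * ((pos_powr (t - u) b - pos_powr (t - m) b) / b - (pos_powr (t - m) b - pos_powr (t - v) b) / b))"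
    unfolding eq using b le
    by (intro has_bochner_integral_mult_right has_bochner_integral_diff integral_pos_powr) auto
  then have "ghbmp_coeff H t j k = 2 powr (real j / 2) * ((pos_powr (t - u) b - pos_powr (t - m) b) / b - (pos_powr (t - m) b - pos_powr (t - v) b) / b)"
    unfolding ghbmp_coeff_def set_lebesgue_integral_def a(1)[symmetric]
    by (rule has_bochner_integral_integral_eq)
  also have "\<dots> = 2 powr (real j / 2) / b * (pos_powr (t - u) b - 2 * pos_powr (t - m) b + pos_powr (t - v) b)"
    using b by (simp add: field_simps)
  also have "pos_powr (t - u) b - 2 * pos_powr (t - m) b + pos_powr (t - v) b = 2 powr (- real j * b) * haar_profile b (2 ^ j * t - real k)"
  proof -
    \<comment> \<open>Homogeneity of degree \<open>b\<close> moves the nodes \<open>u\<close>,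
      \<open>m\<close>, \<open>v\<close> to \<open>k\<close>, \<open>k + 1/2\<close>,
      \<open>k + 1\<close>.\<close>
    have *: "pos_powr (t - w) b = 2 powr (- real j * b) * pos_powr (2 ^ j * t - 2 ^ j * w) b" for w
    proof -
      have "pos_powr (2 ^ j * (t - w)) b = (2 ^ j) powr b * pos_powr (t - w) b"
        by (rule pos_powr_mult) simp
      also have "(2 ^ j) powr b = 2 powr (real j * b)" by (simp add: powr_powr flip: powr_realpow)
      finally show ?thesis by (simp add: powr_minus right_diff_distrib)
    qed
    have **: "2 ^ j * u = real k" "2 ^ j * m = real k + 1/2" "2 ^ j * v = real k + 1"
      by (simp_all add: uv)
    show ?thesis
      unfolding haar_profile_def *[of u] *[of m] *[of v] ** by (simp add: algebra_simps)
  qed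
  also have "2 powr (real j / 2) / b * (2 powr (- real j * b) * haar_profile b (2 ^ j * t - real k)) =
     2 powr (real j / 2 + - real j * b) / b * haar_profile b (2 ^ j * t - real k)"
    by (subst powr_add) simp
  \<comment> \<open>The normalisation of the wavelet is absorbed by the extra \<open>1/2\<close> in
    \<open>b\<close>.\<close>
  also have "real j / 2 + - real j * b = - real j * a" by (simp add: b_def algebra_simps)
  finally show ?thesis by (simp add: b_def)
qed

section \<open>Square sums over one level\<close>

text \<open>The value \<open>0\<close> on \<open>z \<le> 0\<close> records that the profile vanishes
  there, so that at a given point only the translates starting to its left count.\<close>

definition decay_weight :: "real \<Rightarrow> real \<Rightarrow> real" where
  "decay_weight p z = (if z \<le> 0 then 0 else (1 + z) powr (- p))"

text \<open>For \<open>x \<ge> 0\<close> with integer part \<open>n\<close> only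
  \<open>k \<le> n\<close> contribute, and \<open>x - k \<ge> n - k\<close> turns the sum into a
  partial sum of a series in \<open>n - k\<close>. The bound is uniform in \<open>x\<close> and
  \<open>N\<close>; \<open>p > 1/2\<close> makes the series converge.\<close>

lemma sum_decay_weight_square_le:
  assumes p: "1/2 < p"
  shows "(\<Sum>k<N. (decay_weight p (x - real k))\<^sup>2) \<le> (\<Sum>n. (1 + real n) powr (- 2 * p))"
proof -
  have "summable (\<lambda>n. real n powr (- 2 * p))" using p by (simp add: summable_real_powr_iff)
  then have summ: "summable (\<lambda>n. (1 + real n) powr (- 2 * p))"
    by (subst (asm) summable_Suc_iff[symmetric]) (simp add: add.commute)
  show ?thesis
  proof (cases "x < 0")
    case True
    then have "(\<Sum>k<N. (decay_weight p (x - real k))\<^sup>2) = 0"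
      by (intro sum.neutral) (auto simp: decay_weight_def)
    then show ?thesis using summ by (simp add: suminf_nonneg)
  next
    case False
    define n where "n = nat \<lfloor>x\<rfloor>"
    have n: "real n \<le> x" "x < real n + 1" using False by (auto simp: n_def)
    have "(\<Sum>k<N. (decay_weight p (x - real k))\<^sup>2) \<le> (\<Sum>k\<in>{..<N} \<inter> {..n}. (decay_weight p (x - real k))\<^sup>2)"
    proof (rule eq_refl, rule sum.mono_neutral_right, goal_cases)
      case 3
      show ?case
      proof
        fix k assume "k \<in> {..<N} - {..<N} \<inter> {..n}"
        then have "n < k" by auto
        then have "real n + 1 \<le> real k" by linarith
        then show "(decay_weight p (x - real k))\<^sup>2 = 0" using n by (simp add: decay_weight_def)
      qed
    qed auto
    also have "\<dots> \<le> (\<Sum>k\<in>{..n}. (decay_weight p (x - real k))\<^sup>2)"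
      by (intro sum_mono2) auto
    also have "\<dots> \<le> (\<Sum>k\<le>n. (1 + real (n - k)) powr (- 2 * p))"
    proof (intro sum_mono)
      fix k assume k: "k \<in> {..n}"
      have "(decay_weight p (x - real k))\<^sup>2 \<le> ((1 + real (n - k)) powr (- p))\<^sup>2"
      proof (intro power_mono)
        have "(1 + (x - real k)) powr (- p) \<le> (1 + real (n - k)) powr (- p)"
          using k n p by (intro powr_mono2') (auto simp: of_nat_diff)
        then show "decay_weight p (x - real k) \<le> (1 + real (n - k)) powr (- p)" by (simp add: decay_weight_def)
      qed (simp add: decay_weight_def)
      also have "\<dots> = (1 + real (n - k)) powr (- 2 * p)"
        by (simp add: power2_eq_square flip: powr_add)
      finally show "(decay_weight p (x - real k))\<^sup>2 \<le> (1 + real (n - k)) powr (- 2 * p)" .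
    qed
    also have "\<dots> = (\<Sum>k<Suc n. (1 + real k) powr (- 2 * p))"
      using sum.nat_diff_reindex[of "\<lambda>k. (1 + real k) powr (- 2 * p)" "Suc n"]
      by (simp add: lessThan_Suc_atMost)
    also have "\<dots> \<le> (\<Sum>n. (1 + real n) powr (- 2 * p))"
      by (intro sum_le_suminf summ) auto
    finally show ?thesis .
  qed
qed

lemma coeff_prefactor_le:
  assumes "0 < Hlow" "Hlow \<le> a"
  shows "2 powr (- real j * a) / (a + 1/2) \<le> 2 * 2 powr (- real j * Hlow)"
proof -
  have "2 powr (- real j * a) / (a + 1/2) \<le> 2 powr (- real j * a) / (1/2)"
    using assms by (intro divide_left_mono) auto
  also have "\<dots> \<le> 2 * 2 powr (- real j * Hlow)"
    using assms by (simp add: mult_left_mono)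
  finally show ?thesis .
qed

text \<open>The exponent \<open>a\<close> varies with \<open>k\<close>, but
  \<open>p = 3/2 - Hup\<close> is at most \<open>2 - b\<close> for every \<open>b = a + 1/2\<close>
  with \<open>a \<le> Hup\<close>, so a single weight serves the whole level, and
  \<open>Hup < 1\<close> gives \<open>p > 1/2\<close>. The constant is
  \<open>192 = 2 * 96\<close>.\<close>

lemma sum_coeff_square_le:
  assumes H: "\<And>x. x \<in> {0..1} \<Longrightarrow> H j x \<in> {Hlow..Hup}" and Hb: "0 < Hlow" "Hup < 1"
    and p: "p = 3/2 - Hup"
  shows "(\<Sum>k<2^j. (ghbmp_coeff H t j k)\<^sup>2) \<le>
    192\<^sup>2 * (\<Sum>n. (1 + real n) powr (- 2 * p)) * (2 powr (- real j * Hlow))\<^sup>2"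
proof -
  have "(\<Sum>k<2^j. (ghbmp_coeff H t j k)\<^sup>2) \<le> (\<Sum>k<2^j. (192 * 2 powr (- real j * Hlow))\<^sup>2 * (decay_weight p (2^j * t - real k))\<^sup>2)"
  proof (intro sum_mono)
    fix k :: nat assume k: "k \<in> {..<2^j}"
    define a where "a = H j (real k / 2 ^ j)"
    have "real k < real (2 ^ j)" using k by (subst of_nat_less_iff) simp
    then have a: "Hlow \<le> a" "a \<le> Hup" using H[of "real k / 2 ^ j"] by (auto simp: a_def)
    define z where "z = 2^j * t - real k"
    have "\<bar>haar_profile (a + 1/2) z\<bar> \<le> 96 * decay_weight p z"
      using haar_profile_le[of "a + 1/2" p z] a Hb haar_profile_eq_0[of z] by (auto simp: decay_weight_def p)
    then have "2 powr (- real j * a) / (a + 1/2) * \<bar>haar_profile (a + 1/2) z\<bar> \<le> (2 * 2 powr (- real j * Hlow)) * (96 * decay_weight p z)"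
      using a Hb coeff_prefactor_le[of Hlow a j] by (intro mult_mono) auto
    moreover have "ghbmp_coeff H t j k = 2 powr (- real j * a) / (a + 1/2) * haar_profile (a + 1/2) z"
      using ghbmp_coeff_eq[of k j a H t] k a Hb a_def by (simp add: z_def)
    ultimately have "\<bar>ghbmp_coeff H t j k\<bar> \<le> (2 * 2 powr (- real j * Hlow)) * (96 * decay_weight p z)"
      using a Hb by (simp add: abs_mult)
    then have "\<bar>ghbmp_coeff H t j k\<bar>\<^sup>2 \<le> ((2 * 2 powr (- real j * Hlow)) * (96 * decay_weight p z))\<^sup>2"
      by (intro power_mono) auto
    then show "(ghbmp_coeff H t j k)\<^sup>2 \<le> (192 * 2 powr (- real j * Hlow))\<^sup>2 * (decay_weight p (2^j * t - real k))\<^sup>2"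
      by (simp add: power_mult_distrib z_def)
  qed
  also have "\<dots> = (192 * 2 powr (- real j * Hlow))\<^sup>2 * (\<Sum>k<2^j. (decay_weight p (2^j * t - real k))\<^sup>2)"
    by (simp add: sum_distrib_left)
  also have "\<dots> \<le> (192 * 2 powr (- real j * Hlow))\<^sup>2 * (\<Sum>n. (1 + real n) powr (- 2 * p))"
    using Hb by (intro mult_left_mono sum_decay_weight_square_le) (auto simp: p)
  finally show ?thesis by (simp add: power_mult_distrib mult_ac)
qed

text \<open>Estimate for coarse levels. The increment of the profile has exponent
  \<open>min (a + 1/2) 1\<close>, which exceeds \<open>a\<close> by
  \<open>min (1/2) (1 - a) \<ge> \<theta>\<close>; this surplus later makes the sum over the coarse
  levels geometric.\<close>

lemma sum_coeff_diff_square_le: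
  assumes H: "\<And>x. x \<in> {0..1} \<Longrightarrow> H j x \<in> {Hlow..Hup}" and Hb: "0 < Hlow" "Hup < 1"
    and p: "p = 3/2 - Hup" and th: "\<theta> = min (1/2) (1 - Hup)"
    and d: "t' < t''" "t'' - t' \<le> 1" "2 ^ j * (t'' - t') \<le> 1"
  shows "(\<Sum>k<2^j. (ghbmp_coeff H t'' j k - ghbmp_coeff H t' j k)\<^sup>2) \<le>
    192\<^sup>2 * (\<Sum>n. (1 + real n) powr (- 2 * p)) * ((t'' - t') powr Hlow * (2 ^ j * (t'' - t')) powr \<theta>)\<^sup>2"
proof -
  define \<delta> where "\<delta> = t'' - t'"
  have \<delta>: "0 < \<delta>" "\<delta> \<le> 1" using d by (auto simp: \<delta>_def)
  have "(\<Sum>k<2^j. (ghbmp_coeff H t'' j k - ghbmp_coeff H t' j k)\<^sup>2) \<le> (\<Sum>k<2^j. (192 * (\<delta> powr Hlow * (2 ^ j * \<delta>) powr \<theta>))\<^sup>2 * (decay_weight p (2^j * t'' - real k))\<^sup>2)"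
  proof (intro sum_mono)
    fix k :: nat assume k: "k \<in> {..<2^j}"
    define a where "a = H j (real k / 2 ^ j)"
    have "real k < real (2 ^ j)" using k by (subst of_nat_less_iff) simp
    then have a: "Hlow \<le> a" "a \<le> Hup" using H[of "real k / 2 ^ j"] by (auto simp: a_def)
    define z y where "z = 2^j * t'' - real k" and "y = 2^j * t' - real k"
    have zy: "z - y = 2 ^ j * \<delta>" by (simp add: z_def y_def \<delta>_def algebra_simps)
    then have "z > y" using \<delta> by (smt (verit) mult_pos_pos zero_less_power)
    have "\<bar>haar_profile (a + 1/2) z - haar_profile (a + 1/2) y\<bar> \<le> 96 * ((2 ^ j * \<delta>) powr min (a + 1/2) 1 * decay_weight p z)"
    proof (cases "z \<le> 0")
      case True
      then show ?thesis using haar_profile_eq_0[of z] haar_profile_eq_0[of y] \<open>z > y\<close> by (simp add: decay_weight_def)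
    next
      case False
      then show ?thesis
        using haar_profile_diff_le[of "a + 1/2" p y z] a Hb \<open>z > y\<close> d(3) by (simp add: decay_weight_def p zy \<delta>_def)
    qed
    \<comment> \<open>The prefactor keeps the exponent \<open>a\<close> instead of
      \<open>Hlow\<close>, because it has to combine with the \<open>a\<close>-dependent power of
      \<open>2 ^ j * \<delta>\<close> below.\<close>
    then have "2 powr (- real j * a) / (a + 1/2) * \<bar>haar_profile (a + 1/2) z - haar_profile (a + 1/2) y\<bar> \<le> (2 * 2 powr (- real j * a)) * (96 * ((2 ^ j * \<delta>) powr min (a + 1/2) 1 * decay_weight p z))"
      using a Hb coeff_prefactor_le[of a a j] by (intro mult_mono) auto
    moreover have "ghbmp_coeff H t'' j k - ghbmp_coeff H t' j k = 2 powr (- real j * a) / (a + 1/2) * (haar_profile (a + 1/2) z - haar_profile (a + 1/2) y)"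
      using ghbmp_coeff_eq[of k j a H t'] ghbmp_coeff_eq[of k j a H t''] k a Hb a_def
      by (simp add: z_def y_def right_diff_distrib)
    ultimately have "\<bar>ghbmp_coeff H t'' j k - ghbmp_coeff H t' j k\<bar> \<le> 192 * (2 powr (- real j * a) * (2 ^ j * \<delta>) powr min (a + 1/2) 1) * decay_weight p z"
      using a Hb by (simp add: abs_mult mult_ac)
    also have "2 powr (- real j * a) * (2 ^ j * \<delta>) powr min (a + 1/2) 1 \<le> \<delta> powr Hlow * (2 ^ j * \<delta>) powr \<theta>"
    proof -
      \<comment> \<open>The level factor is traded for \<open>\<delta> powr a\<close> and a power of
        \<open>2 ^ j * \<delta>\<close>. Both bases are at most \<open>1\<close>, so lowering the
        exponents to \<open>Hlow\<close> and \<open>\<theta>\<close> only enlarges the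
        product.\<close>
      have "2 powr (- real j * a) = (2 ^ j) powr (- a)" by (simp add: powr_powr flip: powr_realpow)
      also have "\<dots> = \<delta> powr a * (2 ^ j * \<delta>) powr (- a)"
        using \<delta> by (simp add: powr_mult flip: powr_add)
      finally have "2 powr (- real j * a) * (2 ^ j * \<delta>) powr min (a + 1/2) 1 = \<delta> powr a * (2 ^ j * \<delta>) powr (min (a + 1/2) 1 - a)"
        by (simp add: powr_add[symmetric] mult.assoc)
      also have "\<dots> \<le> \<delta> powr Hlow * (2 ^ j * \<delta>) powr \<theta>"
        using \<delta> a d(3) by (intro mult_mono powr_mono') (auto simp: th \<delta>_def)
      finally show ?thesis .
    qed
    finally have "\<bar>ghbmp_coeff H t'' j k - ghbmp_coeff H t' j k\<bar> \<le> 192 * (\<delta> powr Hlow * (2 ^ j * \<delta>) powr \<theta>) * decay_weight p z"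
      by (simp add: decay_weight_def)
    then have "\<bar>ghbmp_coeff H t'' j k - ghbmp_coeff H t' j k\<bar>\<^sup>2 \<le> (192 * (\<delta> powr Hlow * (2 ^ j * \<delta>) powr \<theta>) * decay_weight p z)\<^sup>2"
      by (intro power_mono) auto
    then show "(ghbmp_coeff H t'' j k - ghbmp_coeff H t' j k)\<^sup>2 \<le> (192 * (\<delta> powr Hlow * (2 ^ j * \<delta>) powr \<theta>))\<^sup>2 * (decay_weight p (2^j * t'' - real k))\<^sup>2"
      by (simp add: power_mult_distrib z_def)
  qed
  also have "\<dots> = (192 * (\<delta> powr Hlow * (2 ^ j * \<delta>) powr \<theta>))\<^sup>2 * (\<Sum>k<2^j. (decay_weight p (2^j * t'' - real k))\<^sup>2)"
    by (simp add: sum_distrib_left)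
  also have "\<dots> \<le> (192 * (\<delta> powr Hlow * (2 ^ j * \<delta>) powr \<theta>))\<^sup>2 * (\<Sum>n. (1 + real n) powr (- 2 * p))"
    using Hb by (intro mult_left_mono sum_decay_weight_square_le) (auto simp: p)
  finally show ?thesis by (simp add: power_mult_distrib mult_ac \<delta>_def)
qed

section \<open>Summation over the levels\<close>

text \<open>\<open>Suc n\<close> is the first exponent at which the product exceeds
  \<open>1\<close>; \<open>\<delta> \<le> 1\<close> keeps it from being \<open>0\<close>. The scale
  serves both to split the levels and to compare nearby points in the Hoelder estimate.\<close>

lemma dyadic_scale_exists:
  fixes \<delta> :: real
  assumes "0 < \<delta>" "\<delta> \<le> 1"
  obtains n :: nat where "2 ^ n * \<delta> \<le> 1" "1 < 2 ^ Suc n * \<delta>"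
proof -
  define N where "N = (LEAST m. 1 < 2 ^ m * \<delta>)"
  obtain m where "1 / \<delta> < 2 ^ m" using real_arch_pow[of 2 "1 / \<delta>"] by auto
  then have "1 < 2 ^ m * \<delta>" using assms by (simp add: field_simps)
  then have N: "1 < 2 ^ N * \<delta>" unfolding N_def by (rule LeastI)
  have "N \<noteq> 0"
  proof
    assume "N = 0"
    then show False using N assms by simp
  qed
  then obtain n where n: "N = Suc n" by (cases N) auto
  have "\<not> 1 < 2 ^ n * \<delta>"
    using not_less_Least[of n "\<lambda>m. 1 < 2 ^ m * \<delta>"] n by (simp add: N_def)
  then show thesis using that[of n] N n by simp
qed

text \<open>Away from the level where \<open>2 ^ j * \<delta>\<close> crosses \<open>1\<close> the
  terms are dominated in both directions by powers of \<open>2 powr (- \<tau>)\<close>; two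
  geometric series give the numerator \<open>2\<close>, whatever \<open>\<delta>\<close> is.\<close>

lemma sum_dyadic_le:
  fixes \<delta> \<tau> :: real
  assumes \<delta>: "0 < \<delta>" "\<delta> \<le> 1" and \<tau>: "0 < \<tau>"
  shows "(\<Sum>j<J. if 2 ^ j * \<delta> \<le> 1 then (2 ^ j * \<delta>) powr \<tau> else (2 ^ j * \<delta>) powr (- \<tau>)) \<le> 2 / (1 - 2 powr (- \<tau>))"
proof -
  define \<rho> where "\<rho> = (2::real) powr (- \<tau>)"
  have "\<rho> < 2 powr 0" unfolding \<rho>_def using \<tau> by (intro powr_less_mono) auto
  then have \<rho>: "0 < \<rho>" "\<rho> < 1" by (auto simp: \<rho>_def)
  have \<rho>_pow: "(2 ^ m) powr (- \<tau>) = \<rho> ^ m" for m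
    by (simp add: \<rho>_def powr_powr mult.commute flip: powr_realpow)
  have geo: "(\<Sum>i<m. \<rho> ^ i) \<le> 1 / (1 - \<rho>)" for m
    using sum_le_suminf[of "\<lambda>i. \<rho> ^ i" "{..<m}"] \<rho> by (simp add: suminf_geometric summable_geometric)
  define f where "f j = (if 2 ^ j * \<delta> \<le> 1 then (2 ^ j * \<delta>) powr \<tau> else (2 ^ j * \<delta>) powr (- \<tau>))" for j :: nat
  have f_nonneg: "0 \<le> f j" for j by (simp add: f_def)
  obtain n where n: "2 ^ n * \<delta> \<le> 1" "1 < 2 ^ Suc n * \<delta>"
    using dyadic_scale_exists \<delta> by blast
  define N where "N = Suc n"
  have N: "1 < 2 ^ N * \<delta>" using n by (simp add: N_def)
  have lt_N: "2 ^ j * \<delta> \<le> 1" if "j < N" for j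
  proof -
    have "2 ^ j * \<delta> \<le> 2 ^ n * \<delta>"
      using that \<delta> by (intro mult_right_mono power_increasing) (auto simp: N_def)
    then show ?thesis using n by simp
  qed
  have f_lt: "f j \<le> \<rho> ^ (N - Suc j)" if "j < N" for j
  proof -
    have "2 ^ (N - Suc j) * (2 ^ j * \<delta>) = 2 ^ (N - 1) * \<delta>"
      using that by (simp add: mult.assoc[symmetric] power_add[symmetric])
    also have "\<dots> \<le> 1" using that lt_N[of "N - 1"] by simp
    finally have "2 ^ j * \<delta> \<le> 1 / 2 ^ (N - Suc j)" by (simp add: field_simps)
    then have "(2 ^ j * \<delta>) powr \<tau> \<le> (1 / 2 ^ (N - Suc j)) powr \<tau>"
      using \<tau> \<delta> by (intro powr_mono2) auto
    also have "\<dots> = \<rho> ^ (N - Suc j)"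
      by (simp add: powr_divide powr_minus_divide flip: \<rho>_pow)
    finally show ?thesis using lt_N[OF that] by (simp add: f_def)
  qed
  have f_ge: "f (N + i) \<le> \<rho> ^ i" for i
  proof -
    have *: "2 ^ (N + i) * \<delta> > 2 ^ i"
      using N by (simp add: power_add)
    moreover have "(1::real) \<le> 2 ^ i" by simp
    ultimately have "1 < 2 ^ (N + i) * \<delta>" by linarith
    then have "f (N + i) = (2 ^ (N + i) * \<delta>) powr (- \<tau>)" by (simp add: f_def)
    also have "\<dots> \<le> (2 ^ i) powr (- \<tau>)" using * \<tau> by (intro powr_mono2') auto
    finally show ?thesis by (simp add: \<rho>_pow)
  qed
  have split: "(\<Sum>j<N + J. f j) = (\<Sum>j<N. f j) + (\<Sum>i<J. f (N + i))"
    by (induction J) (auto simp: add.assoc)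
  \<comment> \<open>Extending the range adds nonnegative terms and makes the split at
    \<open>N\<close> available also when \<open>J < N\<close>.\<close>
  have "(\<Sum>j<J. f j) \<le> (\<Sum>j<N + J. f j)"
    using f_nonneg by (intro sum_mono2) auto
  also have "\<dots> \<le> (\<Sum>j<N. \<rho> ^ (N - Suc j)) + (\<Sum>i<J. \<rho> ^ i)"
    unfolding split using f_lt f_ge by (intro add_mono sum_mono) auto
  also have "(\<Sum>j<N. \<rho> ^ (N - Suc j)) = (\<Sum>i<N. \<rho> ^ i)"
    by (rule sum.nat_diff_reindex)
  also have "(\<Sum>i<N. \<rho> ^ i) + (\<Sum>i<J. \<rho> ^ i) \<le> 1 / (1 - \<rho>) + 1 / (1 - \<rho>)"
    by (intro add_mono geo)
  finally show ?thesis by (simp add: f_def \<rho>_def)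
qed

text \<open>Coarse levels profit from the small increment, fine levels from the small coefficients
  themselves. Both bounds factor as \<open>\<bar>t'' - t'\<bar> powr (2 * Hlow)\<close> times a
  power of \<open>2 ^ j * \<bar>t'' - t'\<bar>\<close>, so one constant serves all
  \<open>J\<close>.\<close>

lemma increment_variance_le:
  assumes H: "\<And>j x. x \<in> {0..1} \<Longrightarrow> H j x \<in> {Hlow..Hup}" and Hb: "0 < Hlow" "Hup < 1"
  shows "\<exists>c>0. \<forall>J. \<forall>t'\<in>{0..1}. \<forall>t''\<in>{0..1}.
    (\<Sum>j<J. \<Sum>k<2^j. (ghbmp_coeff H t'' j k - ghbmp_coeff H t' j k)\<^sup>2) \<le> c * \<bar>t'' - t'\<bar> powr (2 * Hlow)"
proof -
  define p where "p = 3/2 - Hup"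
  define \<theta> where "\<theta> = min (1/2) (1 - Hup)"
  \<comment> \<open>The smaller of the two gains, \<open>\<theta>\<close> on coarse and
    \<open>Hlow\<close> on fine levels, doubled because the coefficients are squared.\<close>
  define \<tau> where "\<tau> = 2 * min \<theta> Hlow"
  have \<theta>: "0 < \<theta>" and \<tau>: "0 < \<tau>" using Hb by (auto simp: \<theta>_def \<tau>_def)
  define S where "S = 192\<^sup>2 * (\<Sum>n. (1 + real n) powr (- 2 * p))"
  have S: "0 \<le> S"
    using sum_decay_weight_square_le[of p 0 0] Hb by (simp add: S_def p_def)
  \<comment> \<open>The summand \<open>1\<close> secures \<open>c > 0\<close>, since
    \<open>S\<close> is only known to be nonnegative.\<close>
  define c where "c = 4 * S * (2 / (1 - 2 powr (- \<tau>))) + 1"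
  have "(2::real) powr (- \<tau>) < 2 powr 0" using \<tau> by (intro powr_less_mono) auto
  then have c: "c > 0" unfolding c_def using S
    by (intro add_nonneg_pos mult_nonneg_nonneg divide_nonneg_nonneg) auto
  define V where "V t'' t' j = (\<Sum>k<2^j. (ghbmp_coeff H t'' j k - ghbmp_coeff H t' j k)\<^sup>2)" for t'' t' j
  have level: "V t'' t' j \<le> 4 * S * (t'' - t') powr (2 * Hlow) *
      (if 2 ^ j * (t'' - t') \<le> 1 then (2 ^ j * (t'' - t')) powr \<tau> else (2 ^ j * (t'' - t')) powr (- \<tau>))"
    if t: "t' < t''" "t'' - t' \<le> 1" for t' t'' j
  proof -
    define \<delta> where "\<delta> = t'' - t'"
    have \<delta>: "0 < \<delta>" "\<delta> \<le> 1" using t by (auto simp: \<delta>_def)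
    have sq: "(x powr e)\<^sup>2 = x powr (2 * e)" for x e :: real
      by (simp add: power2_eq_square flip: powr_add)
    show ?thesis
    proof (cases "2 ^ j * \<delta> \<le> 1")
      case True
      have "V t'' t' j \<le> S * (\<delta> powr Hlow * (2 ^ j * \<delta>) powr \<theta>)\<^sup>2"
        unfolding V_def S_def \<delta>_def using t True
        by (intro sum_coeff_diff_square_le[OF H Hb p_def \<theta>_def]) (auto simp: \<delta>_def)
      also have "\<dots> = S * (\<delta> powr (2 * Hlow) * (2 ^ j * \<delta>) powr (2 * \<theta>))"
        by (simp only: power_mult_distrib sq)
      also have "\<dots> \<le> S * (\<delta> powr (2 * Hlow) * (2 ^ j * \<delta>) powr \<tau>)"
        using S \<delta> True by (intro mult_left_mono powr_mono') (auto simp: \<tau>_def)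
      \<comment> \<open>The factor \<open>4\<close> is inserted to match the constant of the fine
        levels.\<close>
      also have "\<dots> \<le> 4 * (S * (\<delta> powr (2 * Hlow) * (2 ^ j * \<delta>) powr \<tau>))"
        using S by simp
      finally show ?thesis using True by (simp add: \<delta>_def mult_ac)
    next
      case False
      have "V t'' t' j \<le> (\<Sum>k<2^j. 2 * (ghbmp_coeff H t'' j k)\<^sup>2 + 2 * (ghbmp_coeff H t' j k)\<^sup>2)"
      proof -
        have "(x - y)\<^sup>2 \<le> 2 * x\<^sup>2 + 2 * y\<^sup>2" for x y :: real
          using zero_le_power2[of "x + y"] by (simp add: power2_eq_square algebra_simps)
        then show ?thesis unfolding V_def by (intro sum_mono)
      qed
      also have "\<dots> = 2 * (\<Sum>k<2^j. (ghbmp_coeff H t'' j k)\<^sup>2) + 2 * (\<Sum>k<2^j. (ghbmp_coeff H t' j k)\<^sup>2)"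
        by (simp add: sum.distrib sum_distrib_left)
      also have "\<dots> \<le> 2 * (S * (2 powr (- real j * Hlow))\<^sup>2) + 2 * (S * (2 powr (- real j * Hlow))\<^sup>2)"
        unfolding S_def by (intro add_mono mult_left_mono sum_coeff_square_le[OF H Hb p_def]) auto
      also have "\<dots> = 4 * S * (2 powr (- real j * Hlow))\<^sup>2" by simp
      also have "2 powr (- real j * Hlow) = \<delta> powr Hlow * (2 ^ j * \<delta>) powr (- Hlow)"
      proof -
        have "2 powr (- real j * Hlow) = (2 ^ j) powr (- Hlow)" by (simp add: powr_powr flip: powr_realpow)
        then show ?thesis using \<delta> by (simp add: powr_mult flip: powr_add)
      qed
      also have "(\<delta> powr Hlow * (2 ^ j * \<delta>) powr (- Hlow))\<^sup>2 = \<delta> powr (2 * Hlow) * (2 ^ j * \<delta>) powr (2 * (- Hlow))"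
        by (simp only: power_mult_distrib sq)
      also have "4 * S * \<dots> \<le> 4 * S * (\<delta> powr (2 * Hlow) * (2 ^ j * \<delta>) powr (- \<tau>))"
        using S \<delta> False by (intro mult_left_mono powr_mono) (auto simp: \<tau>_def)
      finally show ?thesis using False by (simp add: \<delta>_def mult_ac)
    qed
  qed
  have main: "(\<Sum>j<J. V t'' t' j) \<le> c * (t'' - t') powr (2 * Hlow)" if t: "t' < t''" "t'' - t' \<le> 1" for t' t'' J
  proof -
    have "(\<Sum>j<J. V t'' t' j) \<le> 4 * S * (t'' - t') powr (2 * Hlow) *
      (\<Sum>j<J. if 2 ^ j * (t'' - t') \<le> 1 then (2 ^ j * (t'' - t')) powr \<tau> else (2 ^ j * (t'' - t')) powr (- \<tau>))"
      unfolding sum_distrib_left by (intro sum_mono level t)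
    also have "\<dots> \<le> 4 * S * (t'' - t') powr (2 * Hlow) * (2 / (1 - 2 powr (- \<tau>)))"
      using t S \<tau> by (intro mult_left_mono sum_dyadic_le) auto
    also have "\<dots> \<le> c * (t'' - t') powr (2 * Hlow)"
      by (simp add: c_def algebra_simps)
    finally show ?thesis .
  qed
  have sym: "V t'' t' j = V t' t'' j" for t' t'' j
    unfolding V_def by (simp add: power2_commute)
  show ?thesis
  proof (intro exI[of _ c] conjI allI ballI c)
    fix J and t' t'' :: real assume t: "t' \<in> {0..1}" "t'' \<in> {0..1}"
    consider "t' < t''" | "t' = t''" | "t'' < t'" by linarith
    then have "(\<Sum>j<J. V t'' t' j) \<le> c * \<bar>t'' - t'\<bar> powr (2 * Hlow)"
    proof cases
      case 1
      then show ?thesis using main[of t' t'' J] t by simp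
    next
      case 2
      then show ?thesis by (simp add: V_def)
    next
      case 3
      then show ?thesis using main[of t'' t' J] t by (simp add: sym[of t'' t'])
    qed
    then show "(\<Sum>j<J. \<Sum>k<2^j. (ghbmp_coeff H t'' j k - ghbmp_coeff H t' j k)\<^sup>2) \<le> c * \<bar>t'' - t'\<bar> powr (2 * Hlow)"
      by (simp add: V_def)
  qed
qed

section \<open>Gaussian sums and their limits in \<open>L\<^sub>2\<close>\<close>

text \<open>The sum is centred normal with variance the sum of the squared coefficients; dividing by
  its standard deviation reduces the claim to the even moments of the standard normal law.\<close>

lemma (in prob_space) gaussian_sum_even_moment:
  fixes X :: "'i \<Rightarrow> 'a \<Rightarrow> real"
  assumes I: "finite I" and indep: "indep_vars (\<lambda>_. borel) X I"
    and normal: "\<And>i. i \<in> I \<Longrightarrow> distributed M lborel (X i) std_normal_density"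
  shows "has_bochner_integral M (\<lambda>\<omega>. (\<Sum>i\<in>I. a i * X i \<omega>) ^ (2 * m))
           (fact (2 * m) / (2 ^ m * fact m) * (\<Sum>i\<in>I. (a i)\<^sup>2) ^ m)"
proof -
  \<comment> \<open>Zero coefficients are discarded because a normal density requires a positive
    standard deviation.\<close>
  define J where "J = {i\<in>I. a i \<noteq> 0}"
  have J: "finite J" "J \<subseteq> I" using I by (auto simp: J_def)
  have sum_J: "(\<Sum>i\<in>I. a i * X i \<omega>) = (\<Sum>i\<in>J. a i * X i \<omega>)" for \<omega>
    using I by (intro sum.mono_neutral_right) (auto simp: J_def)
  have sq_J: "(\<Sum>i\<in>I. (a i)\<^sup>2) = (\<Sum>i\<in>J. (a i)\<^sup>2)"
    using I by (intro sum.mono_neutral_right) (auto simp: J_def)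
  show ?thesis
  proof (cases "J = {}")
    case True
    \<comment> \<open>If every coefficient vanishes, both sides are \<open>0\<close> for
      \<open>m > 0\<close>, and \<open>1\<close> for \<open>m = 0\<close> because
      \<open>0 ^ 0 = 1\<close>.\<close>
    have "has_bochner_integral M (\<lambda>\<omega>. 0 ^ (2 * m) :: real) (0 ^ (2 * m))"
      by (simp add: has_bochner_integral_iff prob_space)
    then show ?thesis unfolding sum_J sq_J True by (cases m) auto
  next
    case False
    define v where "v = (\<Sum>i\<in>J. (a i)\<^sup>2)"
    have v: "0 < v" unfolding v_def using J False by (intro sum_pos) (auto simp: J_def)
    have "distributed M lborel (\<lambda>\<omega>. \<Sum>i\<in>J. a i * X i \<omega>) (normal_density (\<Sum>i\<in>J. 0) (sqrt (\<Sum>i\<in>J. \<bar>a i\<bar>\<^sup>2)))"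
    proof (rule sum_indep_normal[OF J(1) False])
      show "indep_vars (\<lambda>_. borel) (\<lambda>i \<omega>. a i * X i \<omega>) J"
        by (rule indep_vars_compose2[OF indep_vars_subset[OF indep J(2)]]) auto
      fix i assume i: "i \<in> J"
      then show "0 < \<bar>a i\<bar>" by (auto simp: J_def)
      have "distributed M lborel (\<lambda>x. 0 + a i * X i x) (normal_density (0 + a i * 0) (\<bar>a i\<bar> * 1))"
        using i by (intro normal_density_affine normal) (auto simp: J_def)
      then show "distributed M lborel (\<lambda>\<omega>. a i * X i \<omega>) (normal_density 0 \<bar>a i\<bar>)" by simp
    qed
    then have "distributed M lborel (\<lambda>\<omega>. \<Sum>i\<in>J. a i * X i \<omega>) (normal_density 0 (sqrt v))"
      by (simp add: v_def)
    then have Z: "distributed M lborel (\<lambda>\<omega>. ((\<Sum>i\<in>J. a i * X i \<omega>) - 0) / sqrt v) std_normal_density"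
      by (subst (asm) normal_standard_normal_convert) (use v in auto)
    define Z where "Z \<omega> = (\<Sum>i\<in>J. a i * X i \<omega>) / sqrt v" for \<omega>
    have Z: "distributed M lborel Z std_normal_density" using Z by (simp add: Z_def[abs_def])
    have "has_bochner_integral M (\<lambda>\<omega>. Z \<omega> ^ (2 * m)) (fact (2 * m) / (2 ^ m * fact m))"
      using distributed_integrable[OF Z, of "\<lambda>x. x ^ (2 * m)"] distributed_integral[OF Z, of "\<lambda>x. x ^ (2 * m)"]
        std_normal_moment_even[of m]
      by (simp add: has_bochner_integral_iff)
    from has_bochner_integral_mult_left[OF this, of "v ^ m"]
    have "has_bochner_integral M (\<lambda>\<omega>. Z \<omega> ^ (2 * m) * v ^ m) (fact (2 * m) / (2 ^ m * fact m) * v ^ m)" .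
    also have "(\<lambda>\<omega>. Z \<omega> ^ (2 * m) * v ^ m) = (\<lambda>\<omega>. (\<Sum>i\<in>J. a i * X i \<omega>) ^ (2 * m))"
      using v by (simp add: Z_def power_divide power_mult)
    finally show ?thesis unfolding sum_J sq_J v_def .
  qed
qed

lemma (in prob_space) ghbmp_partial_sum_increment_moment:
  assumes "standard_gaussian_family M \<epsilon>"
  shows "has_bochner_integral M (\<lambda>\<omega>. (ghbmp_partial_sum H \<epsilon> J t'' \<omega> - ghbmp_partial_sum H \<epsilon> J t' \<omega>) ^ (2 * m))
     (fact (2 * m) / (2 ^ m * fact m) * (\<Sum>j<J. \<Sum>k<2^j. (ghbmp_coeff H t'' j k - ghbmp_coeff H t' j k)\<^sup>2) ^ m)"
proof -
  define I where "I = Sigma {..<J} (\<lambda>j. {..<2 ^ j :: nat})"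
  have "indep_vars (\<lambda>_. borel) (\<lambda>(j, k). \<epsilon> j k) I"
    using assms unfolding standard_gaussian_family_def
    by (elim conjE indep_vars_subset) (auto simp: I_def)
  moreover have "distributed M lborel ((\<lambda>(j, k). \<epsilon> j k) i) std_normal_density" if "i \<in> I" for i
    using assms that unfolding standard_gaussian_family_def by (auto simp: I_def)
  moreover have "finite I" by (simp add: I_def)
  ultimately have mom: "has_bochner_integral M
      (\<lambda>\<omega>. (\<Sum>i\<in>I. (case i of (j, k) \<Rightarrow> ghbmp_coeff H t'' j k - ghbmp_coeff H t' j k) * (\<lambda>(j, k). \<epsilon> j k) i \<omega>) ^ (2 * m))
      (fact (2 * m) / (2 ^ m * fact m) * (\<Sum>i\<in>I. (case i of (j, k) \<Rightarrow> ghbmp_coeff H t'' j k - ghbmp_coeff H t' j k)\<^sup>2) ^ m)"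
    by (intro gaussian_sum_even_moment)
  have eq1: "(\<Sum>i\<in>I. (case i of (j, k) \<Rightarrow> ghbmp_coeff H t'' j k - ghbmp_coeff H t' j k) * (\<lambda>(j, k). \<epsilon> j k) i \<omega>) =
      ghbmp_partial_sum H \<epsilon> J t'' \<omega> - ghbmp_partial_sum H \<epsilon> J t' \<omega>" for \<omega>
  proof -
    have "(\<Sum>i\<in>I. (case i of (j, k) \<Rightarrow> ghbmp_coeff H t'' j k - ghbmp_coeff H t' j k) * (\<lambda>(j, k). \<epsilon> j k) i \<omega>) =
      (\<Sum>j<J. \<Sum>k<2^j. (ghbmp_coeff H t'' j k - ghbmp_coeff H t' j k) * \<epsilon> j k \<omega>)"
      unfolding I_def by (subst sum.Sigma) (auto intro!: sum.cong)
    then show ?thesis by (simp add: ghbmp_partial_sum_def left_diff_distrib sum_subtractf)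
  qed
  have eq2: "(\<Sum>i\<in>I. (case i of (j, k) \<Rightarrow> ghbmp_coeff H t'' j k - ghbmp_coeff H t' j k)\<^sup>2) =
      (\<Sum>j<J. \<Sum>k<2^j. (ghbmp_coeff H t'' j k - ghbmp_coeff H t' j k)\<^sup>2)"
    unfolding I_def by (subst sum.Sigma) (auto intro!: sum.cong)
  show ?thesis using mom unfolding eq1 eq2 .
qed

section \<open>Passage to the limit\<close>

lemma square_integrable_diff:
  assumes "square_integrable M f" "square_integrable M g"
  shows "square_integrable M (\<lambda>\<omega>. f \<omega> - g \<omega>)"
proof -
  have [measurable]: "f \<in> borel_measurable M" "g \<in> borel_measurable M"
    using assms by (auto simp: square_integrable_def)
  have "integrable M (\<lambda>\<omega>. (f \<omega> - g \<omega>)\<^sup>2)"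
  proof (rule Bochner_Integration.integrable_bound)
    show "integrable M (\<lambda>\<omega>. 2 * (f \<omega>)\<^sup>2 + 2 * (g \<omega>)\<^sup>2)"
      using assms by (simp add: square_integrable_def)
    have "norm ((x - y)\<^sup>2) \<le> norm (2 * x\<^sup>2 + 2 * y\<^sup>2)" for x y :: real
    proof -
      have "(x - y)\<^sup>2 \<le> 2 * x\<^sup>2 + 2 * y\<^sup>2"
        using zero_le_power2[of "x + y"] by (simp add: power2_eq_square algebra_simps)
      then show ?thesis by simp
    qed
    then show "AE \<omega> in M. norm ((f \<omega> - g \<omega>)\<^sup>2) \<le> norm (2 * (f \<omega>)\<^sup>2 + 2 * (g \<omega>)\<^sup>2)"
      by (intro AE_I2)
  qed measurable
  then show ?thesis by (simp add: square_integrable_def)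
qed

text \<open>Only the order of magnitude matters, so a three-term inequality for
  \<open>f - g = (f - S n) + (S n - T n) + (T n - g)\<close> replaces Minkowski's inequality; the
  outer terms vanish in the limit and the factor \<open>3\<close> remains.\<close>

lemma tendsto_L2_second_moment_le:
  assumes f: "tendsto_L2 M S f" and g: "tendsto_L2 M T g"
    and le: "\<And>n. (\<integral>\<omega>. (S n \<omega> - T n \<omega>)\<^sup>2 \<partial>M) \<le> v"
  shows "(\<integral>\<omega>. (f \<omega> - g \<omega>)\<^sup>2 \<partial>M) \<le> 3 * v"
proof (rule LIMSEQ_le_const)
  let ?r = "\<lambda>n. 3 * (\<integral>\<omega>. (S n \<omega> - f \<omega>)\<^sup>2 \<partial>M) + 3 * v + 3 * (\<integral>\<omega>. (T n \<omega> - g \<omega>)\<^sup>2 \<partial>M)"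
  have "?r \<longlonglongrightarrow> 3 * 0 + 3 * v + 3 * 0"
    using f g unfolding tendsto_L2_def by (intro tendsto_intros) auto
  then show "?r \<longlonglongrightarrow> 3 * v" by simp
  have int: "integrable M (\<lambda>\<omega>. (p \<omega> - q \<omega>)\<^sup>2)" if "square_integrable M p" "square_integrable M q" for p q
    using square_integrable_diff[OF that] by (simp add: square_integrable_def)
  have si: "square_integrable M f" "square_integrable M g" "\<And>n. square_integrable M (S n)" "\<And>n. square_integrable M (T n)"
    using f g by (auto simp: tendsto_L2_def)
  have "(\<integral>\<omega>. (f \<omega> - g \<omega>)\<^sup>2 \<partial>M) \<le> ?r n" for n
  proof -
    \<comment> \<open>The right side minus the left side is the sum of the three squares
      supplied.\<close>
    have ineq: "(x - y)\<^sup>2 \<le> 3 * (s - x)\<^sup>2 + 3 * (s - t)\<^sup>2 + 3 * (t - y)\<^sup>2" for x y s t :: real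
      using zero_le_power2[of "(s - x) + (s - t)"] zero_le_power2[of "(s - t) - (t - y)"] zero_le_power2[of "(s - x) + (t - y)"]
      by (simp add: power2_eq_square algebra_simps)
    have "(\<integral>\<omega>. (f \<omega> - g \<omega>)\<^sup>2 \<partial>M) \<le> (\<integral>\<omega>. 3 * (S n \<omega> - f \<omega>)\<^sup>2 + 3 * (S n \<omega> - T n \<omega>)\<^sup>2 + 3 * (T n \<omega> - g \<omega>)\<^sup>2 \<partial>M)"
      using si by (intro integral_mono ineq int Bochner_Integration.integrable_add integrable_mult_right)
    also have "\<dots> = 3 * (\<integral>\<omega>. (S n \<omega> - f \<omega>)\<^sup>2 \<partial>M) + 3 * (\<integral>\<omega>. (S n \<omega> - T n \<omega>)\<^sup>2 \<partial>M) + 3 * (\<integral>\<omega>. (T n \<omega> - g \<omega>)\<^sup>2 \<partial>M)"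
      using si by (simp add: int)
    also have "\<dots> \<le> ?r n" using le by simp
    finally show ?thesis .
  qed
  then show "\<exists>N. \<forall>n\<ge>N. (\<integral>\<omega>. (f \<omega> - g \<omega>)\<^sup>2 \<partial>M) \<le> ?r n" by blast
qed

lemma (in prob_space) prob_abs_ge_le:
  fixes u :: "'a \<Rightarrow> real"
  assumes "integrable M (\<lambda>\<omega>. u \<omega> ^ (2 * m))" "0 < c" and [measurable]: "u \<in> borel_measurable M"
  shows "prob {\<omega>\<in>space M. \<bar>u \<omega>\<bar> \<ge> c} \<le> expectation (\<lambda>\<omega>. u \<omega> ^ (2 * m)) / c ^ (2 * m)"
proof -
  have "prob {\<omega>\<in>space M. \<bar>u \<omega>\<bar> \<ge> c} \<le> prob {\<omega>\<in>space M. u \<omega> ^ (2 * m) \<ge> c ^ (2 * m)}"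
  proof (intro finite_measure_mono subsetI)
    fix \<omega> assume "\<omega> \<in> {\<omega>\<in>space M. \<bar>u \<omega>\<bar> \<ge> c}"
    moreover from this have "c ^ (2 * m) \<le> \<bar>u \<omega>\<bar> ^ (2 * m)" using assms by (intro power_mono) auto
    ultimately show "\<omega> \<in> {\<omega>\<in>space M. u \<omega> ^ (2 * m) \<ge> c ^ (2 * m)}" by (simp add: power_even_abs)
  qed measurable
  also have "\<dots> \<le> expectation (\<lambda>\<omega>. u \<omega> ^ (2 * m)) / c ^ (2 * m)"
    using assms by (intro integral_Markov_inequality_measure[of _ _ "{}"]) auto
  finally show ?thesis .
qed

text \<open>Mean-square convergence alone does not carry higher moments to the limit, so the
  estimate is transferred through probabilities. A gap of \<open>c\<close> between \<open>f\<close>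
  and \<open>g\<close> forces a gap of \<open>c / 4\<close> at one of the two approximations or of
  \<open>c / 2\<close> between them; Chebyshev's inequality makes the approximation events
  negligible as \<open>n\<close> grows.\<close>

lemma (in prob_space) tendsto_L2_tail_le:
  assumes f: "tendsto_L2 M S f" and g: "tendsto_L2 M T g"
    and int: "\<And>n. integrable M (\<lambda>\<omega>. (S n \<omega> - T n \<omega>) ^ (2 * m))"
    and le: "\<And>n. expectation (\<lambda>\<omega>. (S n \<omega> - T n \<omega>) ^ (2 * m)) \<le> w"
    and c: "0 < c"
  shows "prob {\<omega>\<in>space M. \<bar>f \<omega> - g \<omega>\<bar> \<ge> c} \<le> w / (c / 2) ^ (2 * m)"
proof (rule LIMSEQ_le_const)
  let ?r = "\<lambda>n. expectation (\<lambda>\<omega>. (S n \<omega> - f \<omega>)\<^sup>2) / (c / 4)\<^sup>2 + w / (c / 2) ^ (2 * m)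
     + expectation (\<lambda>\<omega>. (T n \<omega> - g \<omega>)\<^sup>2) / (c / 4)\<^sup>2"
  have "?r \<longlonglongrightarrow> 0 / (c / 4)\<^sup>2 + w / (c / 2) ^ (2 * m) + 0 / (c / 4)\<^sup>2"
    using f g c unfolding tendsto_L2_def by (intro tendsto_intros) auto
  then show "?r \<longlonglongrightarrow> w / (c / 2) ^ (2 * m)" by simp
  have si: "square_integrable M f" "square_integrable M g" "\<And>n. square_integrable M (S n)" "\<And>n. square_integrable M (T n)"
    using f g by (auto simp: tendsto_L2_def)
  then have [measurable]: "f \<in> borel_measurable M" "g \<in> borel_measurable M"
    "\<And>n. S n \<in> borel_measurable M" "\<And>n. T n \<in> borel_measurable M"
    by (auto simp: square_integrable_def)
  have "prob {\<omega>\<in>space M. \<bar>f \<omega> - g \<omega>\<bar> \<ge> c} \<le> ?r n" for n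
  proof -
    let ?A = "{\<omega>\<in>space M. \<bar>S n \<omega> - f \<omega>\<bar> \<ge> c / 4}"
    let ?B = "{\<omega>\<in>space M. \<bar>S n \<omega> - T n \<omega>\<bar> \<ge> c / 2}"
    let ?C = "{\<omega>\<in>space M. \<bar>T n \<omega> - g \<omega>\<bar> \<ge> c / 4}"
    have "prob {\<omega>\<in>space M. \<bar>f \<omega> - g \<omega>\<bar> \<ge> c} \<le> prob (?A \<union> ?B \<union> ?C)"
    proof (intro finite_measure_mono subsetI)
      fix \<omega> assume \<omega>: "\<omega> \<in> {\<omega>\<in>space M. \<bar>f \<omega> - g \<omega>\<bar> \<ge> c}"
      then have "\<bar>S n \<omega> - f \<omega>\<bar> \<ge> c / 4 \<or> \<bar>S n \<omega> - T n \<omega>\<bar> \<ge> c / 2 \<or> \<bar>T n \<omega> - g \<omega>\<bar> \<ge> c / 4"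
        by (simp only: mem_Collect_eq) arith
      then show "\<omega> \<in> ?A \<union> ?B \<union> ?C" using \<omega> by blast
    qed measurable
    also have "\<dots> \<le> prob (?A \<union> ?B) + prob ?C"
      by (intro measure_Un_le) auto
    also have "\<dots> \<le> (prob ?A + prob ?B) + prob ?C"
      by (intro add_right_mono measure_Un_le) auto
    also have "\<dots> \<le> ?r n"
    proof (intro add_mono)
      show "prob ?A \<le> expectation (\<lambda>\<omega>. (S n \<omega> - f \<omega>)\<^sup>2) / (c / 4)\<^sup>2"
        using prob_abs_ge_le[of "\<lambda>\<omega>. S n \<omega> - f \<omega>" 1 "c / 4"] square_integrable_diff[OF si(3,1), of n] c
        by (simp add: square_integrable_def)
      show "prob ?C \<le> expectation (\<lambda>\<omega>. (T n \<omega> - g \<omega>)\<^sup>2) / (c / 4)\<^sup>2"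
        using prob_abs_ge_le[of "\<lambda>\<omega>. T n \<omega> - g \<omega>" 1 "c / 4"] square_integrable_diff[OF si(4,2), of n] c
        by (simp add: square_integrable_def)
      have "prob ?B \<le> expectation (\<lambda>\<omega>. (S n \<omega> - T n \<omega>) ^ (2 * m)) / (c / 2) ^ (2 * m)"
        using int c by (intro prob_abs_ge_le) auto
      also have "\<dots> \<le> w / (c / 2) ^ (2 * m)" using le c by (intro divide_right_mono) auto
      finally show "prob ?B \<le> w / (c / 2) ^ (2 * m)" .
    qed
    finally show ?thesis .
  qed
  then show "\<exists>N. \<forall>n\<ge>N. prob {\<omega>\<in>space M. \<bar>f \<omega> - g \<omega>\<bar> \<ge> c} \<le> ?r n" by blast
qed

section \<open>Kolmogorov--Chentsov continuity\<close>

definition dyadic_floor :: "nat \<Rightarrow> real \<Rightarrow> real" where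
  "dyadic_floor n t = of_int \<lfloor>2 ^ n * t\<rfloor> / 2 ^ n"

lemma dyadic_floor_01:
  assumes "t \<in> {0..1}"
  obtains k where "k \<le> 2 ^ n" "dyadic_floor n t = real k / 2 ^ n" "\<lfloor>2 ^ n * t\<rfloor> = int k"
proof -
  define k where "k = nat \<lfloor>2 ^ n * t\<rfloor>"
  have k: "\<lfloor>2 ^ n * t\<rfloor> = int k" using assms by (simp add: k_def)
  have "2 ^ n * t \<le> 2 ^ n" using assms by (simp add: mult_left_le)
  then have "real k \<le> 2 ^ n" using k by linarith
  then have "k \<le> 2 ^ n" by (metis of_nat_le_iff of_nat_numeral of_nat_power)
  then show thesis using that k by (simp add: dyadic_floor_def)
qed

lemma dyadic_floor_mem: "t \<in> {0..1} \<Longrightarrow> dyadic_floor n t \<in> {0..1}"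
proof -
  assume "t \<in> {0..1}"
  then obtain k where k: "k \<le> 2 ^ n" "dyadic_floor n t = real k / 2 ^ n"
    by (metis dyadic_floor_01)
  from k(1) have "real k \<le> 2 ^ n" by (metis of_nat_le_iff of_nat_numeral of_nat_power)
  then show ?thesis using k by simp
qed

lemma dyadic_floor_dist: "\<bar>t - dyadic_floor n t\<bar> \<le> 1 / 2 ^ n"
proof -
  have "\<bar>2 ^ n * t - of_int \<lfloor>2 ^ n * t\<rfloor>\<bar> \<le> 1" by linarith
  moreover have "t - dyadic_floor n t = (2 ^ n * t - of_int \<lfloor>2 ^ n * t\<rfloor>) / 2 ^ n"
    by (simp add: dyadic_floor_def diff_divide_distrib)
  ultimately show ?thesis by (simp add: divide_right_mono)
qed

text \<open>The deterministic half of the Kolmogorov-Chentsov argument. Refining the floor by one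
  level moves it by at most one grid step, so the values along the floors converge geometrically;
  two points at distance at most \<open>1 / 2 ^ n\<close> have equal or adjacent floors at level
  \<open>n\<close>. Since \<open>f\<close> is controlled on the grids only, the conclusion concerns
  the limit and not \<open>f\<close> itself.\<close>

lemma holder_on_dyadic_limit:
  fixes f :: "real \<Rightarrow> real"
  assumes \<gamma>: "0 < \<gamma>" and K: "0 \<le> K"
    and f: "\<And>n k. k < 2 ^ n \<Longrightarrow> \<bar>f ((real k + 1) / 2 ^ n) - f (real k / 2 ^ n)\<bar> \<le> K * 2 powr (- \<gamma> * real n)"
  shows "\<And>t. t \<in> {0..1} \<Longrightarrow> convergent (\<lambda>n. f (dyadic_floor n t))"
    and "holder_on \<gamma> {0..1} (\<lambda>t. lim (\<lambda>n. f (dyadic_floor n t)))"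
proof -
  define r where "r = (2::real) powr (- \<gamma>)"
  have "r < 2 powr 0" unfolding r_def using \<gamma> by (intro powr_less_mono) auto
  then have r: "0 < r" "r < 1" by (auto simp: r_def)
  have r_pow: "2 powr (- \<gamma> * real n) = r ^ n" for n
    by (simp add: r_def powr_powr flip: powr_realpow)
  \<comment> \<open>Chosen so that \<open>K * r ^ n\<close> is the telescoping difference
    \<open>C * (r ^ n - r ^ Suc n)\<close>.\<close>
  define C where "C = K / (1 - r)"
  have C: "0 \<le> C" "K = C * (1 - r)" using r K by (auto simp: C_def)
  define g where "g t = lim (\<lambda>n. f (dyadic_floor n t))" for t
  have step: "\<bar>f (dyadic_floor (Suc n) t) - f (dyadic_floor n t)\<bar> \<le> K * r ^ Suc n" if t: "t \<in> {0..1}" for n t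
  proof -
    obtain k where k: "dyadic_floor n t = real k / 2 ^ n" "\<lfloor>2 ^ n * t\<rfloor> = int k"
      using dyadic_floor_01[OF t] by metis
    obtain l where l: "l \<le> 2 ^ Suc n" "dyadic_floor (Suc n) t = real l / 2 ^ Suc n" "\<lfloor>2 ^ Suc n * t\<rfloor> = int l"
      using dyadic_floor_01[OF t] by metis
    have "real k \<le> 2 ^ n * t" "2 ^ n * t < real k + 1" "real l \<le> 2 * (2 ^ n * t)" "2 * (2 ^ n * t) < real l + 1"
      using k(2) l(3) by (simp_all add: floor_eq_iff mult.assoc)
    \<comment> \<open>The next binary digit of \<open>t\<close>: for \<open>0\<close> the two floors
      coincide, for \<open>1\<close> they are the ends of one cell of level
      \<open>Suc n\<close>.\<close>
    then have "l = 2 * k \<or> l = 2 * k + 1" by linarith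
    then show ?thesis
    proof
      assume "l = 2 * k"
      then show ?thesis using k l K r by simp
    next
      assume eq: "l = 2 * k + 1"
      then have "\<bar>f ((real (2 * k) + 1) / 2 ^ Suc n) - f (real (2 * k) / 2 ^ Suc n)\<bar> \<le> K * r ^ Suc n"
        using f[of "2 * k" "Suc n"] l(1) r_pow[of "Suc n"] by simp
      then show ?thesis using k l eq by (simp add: add.commute)
    qed
  qed
  have bound: "\<bar>f (dyadic_floor (n + i) t) - f (dyadic_floor n t)\<bar> \<le> C * (r ^ n - r ^ (n + i))" if t: "t \<in> {0..1}" for n i t
  proof (induction i)
    case (Suc i)
    have "\<bar>f (dyadic_floor (n + Suc i) t) - f (dyadic_floor n t)\<bar> \<le>
        \<bar>f (dyadic_floor (n + i) t) - f (dyadic_floor n t)\<bar> + \<bar>f (dyadic_floor (Suc (n + i)) t) - f (dyadic_floor (n + i) t)\<bar>"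
      by simp
    also have "\<dots> \<le> C * (r ^ n - r ^ (n + i)) + K * r ^ Suc (n + i)"
      by (intro add_mono Suc.IH step t)
    also have "K * r ^ Suc (n + i) \<le> K * r ^ (n + i)"
      using r K by (intro mult_left_mono power_decreasing) auto
    also have "C * (r ^ n - r ^ (n + i)) + K * r ^ (n + i) = C * (r ^ n - r ^ (n + Suc i))"
      by (simp add: C(2) algebra_simps)
    finally show ?case by simp
  qed simp
  show conv: "convergent (\<lambda>n. f (dyadic_floor n t))" if t: "t \<in> {0..1}" for t
  proof -
    have "summable (\<lambda>n. K * r ^ Suc n)"
      using r by (intro summable_mult) (simp add: summable_Suc_iff summable_geometric)
    then have "summable (\<lambda>n. f (dyadic_floor (Suc n) t) - f (dyadic_floor n t))"
      by (rule summable_comparison_test'[where N = 0]) (use step t in auto)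
    then have "convergent (\<lambda>m. \<Sum>n<m. f (dyadic_floor (Suc n) t) - f (dyadic_floor n t))"
      by (simp add: summable_iff_convergent)
    then have "convergent (\<lambda>m. f (dyadic_floor m t) - f (dyadic_floor 0 t))"
      by (simp add: sum_lessThan_telescope[of "\<lambda>n. f (dyadic_floor n t)"])
    then show ?thesis by (simp add: convergent_diff_const_right_iff)
  qed
  have lim_bound: "\<bar>g t - f (dyadic_floor n t)\<bar> \<le> C * r ^ n" if t: "t \<in> {0..1}" for n t
  proof (rule LIMSEQ_le_const2)
    have "(\<lambda>n. f (dyadic_floor n t)) \<longlonglongrightarrow> g t"
      using conv[OF t] by (simp add: g_def convergent_LIMSEQ_iff)
    then have "(\<lambda>i. f (dyadic_floor (i + n) t)) \<longlonglongrightarrow> g t" by (rule LIMSEQ_ignore_initial_segment)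
    then show "(\<lambda>i. \<bar>f (dyadic_floor (n + i) t) - f (dyadic_floor n t)\<bar>) \<longlonglongrightarrow> \<bar>g t - f (dyadic_floor n t)\<bar>"
      by (intro tendsto_intros) (simp add: add.commute)
    have "\<bar>f (dyadic_floor (n + i) t) - f (dyadic_floor n t)\<bar> \<le> C * r ^ n" for i
    proof -
      have "C * (r ^ n - r ^ (n + i)) \<le> C * r ^ n" using C r by (intro mult_left_mono) auto
      then show ?thesis using bound[OF t, of n i] by linarith
    qed
    then show "\<exists>N. \<forall>i\<ge>N. \<bar>f (dyadic_floor (n + i) t) - f (dyadic_floor n t)\<bar> \<le> C * r ^ n" by blast
  qed
  \<comment> \<open>\<open>2 * C\<close> pays for passing from the grid to the limits at both
    points, \<open>K\<close> for one grid step between the floors, and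
    \<open>2 powr \<gamma>\<close> for \<open>1 / 2 ^ n < 2 * \<delta>\<close>.\<close>
  define L where "L = (2 * C + K) * 2 powr \<gamma>"
  have main: "\<bar>g t - g s\<bar> \<le> L * \<bar>t - s\<bar> powr \<gamma>" if s: "s \<in> {0..1}" and t: "t \<in> {0..1}" and "s < t" for s t
  proof -
    define \<delta> where "\<delta> = t - s"
    have \<delta>: "0 < \<delta>" "\<delta> \<le> 1" using that by (auto simp: \<delta>_def)
    obtain n where n: "2 ^ n * \<delta> \<le> 1" "1 < 2 ^ Suc n * \<delta>" using dyadic_scale_exists \<delta> by blast
    obtain k where k: "dyadic_floor n s = real k / 2 ^ n" "\<lfloor>2 ^ n * s\<rfloor> = int k"
      using dyadic_floor_01[OF s] by metis
    obtain l where l: "l \<le> 2 ^ n" "dyadic_floor n t = real l / 2 ^ n" "\<lfloor>2 ^ n * t\<rfloor> = int l"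
      using dyadic_floor_01[OF t] by metis
    have "real k \<le> 2 ^ n * s" "2 ^ n * s < real k + 1" "real l \<le> 2 ^ n * t" "2 ^ n * t < real l + 1"
      using k(2) l(3) by (simp_all add: floor_eq_iff)
    moreover have "2 ^ n * s \<le> 2 ^ n * t" using \<open>s < t\<close> by simp
    moreover have "2 ^ n * t \<le> 2 ^ n * s + 1" using n(1) by (simp add: \<delta>_def algebra_simps)
    ultimately have "l = k \<or> l = k + 1" by linarith
    then have adj: "\<bar>f (dyadic_floor n t) - f (dyadic_floor n s)\<bar> \<le> K * r ^ n"
    proof
      assume "l = k"
      then show ?thesis using k l K r by simp
    next
      assume "l = k + 1"
      then show ?thesis using k l f[of k n] r_pow[of n] by (simp add: add.commute)
    qed
    have "r ^ n = (1 / 2 ^ n) powr \<gamma>"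
      by (simp add: r_pow[symmetric] powr_divide powr_powr powr_minus_divide mult.commute flip: powr_realpow)
    also have "\<dots> \<le> (2 * \<delta>) powr \<gamma>"
      using n(2) \<gamma> by (intro powr_mono2) (auto simp: field_simps)
    also have "\<dots> = 2 powr \<gamma> * \<delta> powr \<gamma>" using \<delta> by (simp add: powr_mult)
    finally have rn: "r ^ n \<le> 2 powr \<gamma> * \<delta> powr \<gamma>" .
    have "\<bar>g t - g s\<bar> \<le> (2 * C + K) * r ^ n"
      using lim_bound[OF t, of n] lim_bound[OF s, of n] adj unfolding distrib_right by linarith
    also have "\<dots> \<le> (2 * C + K) * (2 powr \<gamma> * \<delta> powr \<gamma>)"
      using rn C K by (intro mult_left_mono) auto
    finally show ?thesis using \<open>s < t\<close> by (simp add: L_def \<delta>_def mult_ac)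
  qed
  have "\<bar>g t - g s\<bar> \<le> L * \<bar>t - s\<bar> powr \<gamma>" if "s \<in> {0..1}" "t \<in> {0..1}" for s t
  proof (cases s t rule: linorder_cases)
    case less
    then show ?thesis using main[of s t] that by simp
  next
    case greater
    then show ?thesis using main[of t s] that by (simp add: abs_minus_commute)
  qed simp
  then show "holder_on \<gamma> {0..1} (\<lambda>t. lim (\<lambda>n. f (dyadic_floor n t)))"
    unfolding holder_on_def g_def by blast
qed

section \<open>Almost sure bounds for dyadic increments\<close>

text \<open>Borel-Cantelli with a geometric majorant; it is applied to the grid increments and again
  to the approximation of \<open>X t\<close> by grid values.\<close>

lemma (in prob_space) AE_eventually_notin_of_geometric:
  fixes u :: "nat \<Rightarrow> 'a \<Rightarrow> real"
  assumes A: "\<And>n. A n \<in> events" and K: "\<And>n. prob (A n) \<le> K * (1/2) ^ n"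
  shows "AE \<omega> in M. eventually (\<lambda>n. \<omega> \<notin> A n) sequentially"
proof -
  have "summable (\<lambda>n. K * (1/2::real) ^ n)"
    by (intro summable_mult summable_geometric) simp
  then have "summable (\<lambda>n. prob (A n))"
    by (rule summable_comparison_test'[where N = 0]) (use K in auto)
  then have "AE \<omega> in M. eventually (\<lambda>n. \<omega> \<in> space M - A n) sequentially"
    by (intro borel_cantelli_AE1 A) (auto simp: emeasure_eq_measure)
  then show ?thesis by (auto elim!: eventually_mono)
qed

text \<open>The form with arbitrary pairs at distance at most \<open>1 / 2 ^ n\<close> serves both
  neighbouring grid points and a point together with its dyadic floor.\<close>

lemma (in prob_space) tail_dyadic_le:
  fixes X :: "real \<Rightarrow> 'a \<Rightarrow> real"
  assumes tail: "\<And>m. \<exists>K. \<forall>s\<in>{0..1}. \<forall>t\<in>{0..1}. \<forall>c>0.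
      prob {\<omega>\<in>space M. \<bar>X t \<omega> - X s \<omega>\<bar> \<ge> c} \<le> K * (\<bar>t - s\<bar> powr h / c) ^ (2 * m)"
    and \<gamma>: "\<gamma> < h" and h: "0 < h"
  shows "\<exists>K\<ge>0. \<forall>n. \<forall>s\<in>{0..1}. \<forall>t\<in>{0..1}. \<bar>t - s\<bar> \<le> 1 / 2 ^ n \<longrightarrow>
      prob {\<omega>\<in>space M. \<bar>X t \<omega> - X s \<omega>\<bar> \<ge> 2 powr (- \<gamma> * real n)} \<le> K * (1/4) ^ n"
proof -
  \<comment> \<open>With this exponent the tail is of order \<open>4 powr (- n)\<close>, which beats the \<open>2 ^ n\<close> increments of level \<open>n\<close>.\<close>
  define m where "m = nat \<lceil>1 / (h - \<gamma>)\<rceil>"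
  have "1 / (h - \<gamma>) \<le> real m" unfolding m_def by linarith
  then have m: "1 \<le> (h - \<gamma>) * real m" using \<gamma> by (simp add: field_simps)
  obtain K where K: "\<And>s t c. s \<in> {0..1} \<Longrightarrow> t \<in> {0..1} \<Longrightarrow> c > 0 \<Longrightarrow>
      prob {\<omega>\<in>space M. \<bar>X t \<omega> - X s \<omega>\<bar> \<ge> c} \<le> K * (\<bar>t - s\<bar> powr h / c) ^ (2 * m)"
    using tail[of m] by blast
  show ?thesis
  proof (intro exI[of _ "\<bar>K\<bar>"] conjI allI ballI impI)
    fix n :: nat and s t :: real assume st: "s \<in> {0..1}" "t \<in> {0..1}" "\<bar>t - s\<bar> \<le> 1 / 2 ^ n"
    define c where "c = 2 powr (- \<gamma> * real n)"
    have c: "c > 0" by (simp add: c_def)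
    have "\<bar>t - s\<bar> powr h \<le> (1 / 2 ^ n) powr h" using st h by (intro powr_mono2) auto
    also have "\<dots> = 2 powr (- h * real n)"
      by (simp add: powr_divide powr_powr powr_minus_divide mult.commute flip: powr_realpow)
    finally have "\<bar>t - s\<bar> powr h / c \<le> 2 powr (- h * real n) / c"
      using c by (intro divide_right_mono) auto
    also have "\<dots> = 2 powr (- (h - \<gamma>) * real n)"
      by (simp add: c_def powr_diff[symmetric] algebra_simps)
    finally have "(\<bar>t - s\<bar> powr h / c) ^ (2 * m) \<le> (2 powr (- (h - \<gamma>) * real n)) ^ (2 * m)"
      using c by (intro power_mono) auto
    also have "\<dots> = 2 powr (- (h - \<gamma>) * real n * real (2 * m))"
      by (subst powr_realpow[symmetric]) (auto simp: powr_powr)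
    also have "\<dots> \<le> 2 powr (- 2 * real n)"
    proof (intro powr_mono)
      have "2 * real n * 1 \<le> 2 * real n * ((h - \<gamma>) * real m)" using m by (intro mult_left_mono) auto
      then show "- (h - \<gamma>) * real n * real (2 * m) \<le> - 2 * real n" by (simp add: algebra_simps)
    qed simp
    also have "2 powr (- 2 * real n) = (1/4) ^ n"
    proof -
      have "2 powr (- 2 * real n) = (2 powr (- 2)) powr real n" by (simp add: powr_powr)
      also have "\<dots> = (1/4) ^ n" by (subst powr_realpow) (auto simp: powr_minus_divide)
      finally show ?thesis .
    qed
    finally have *: "(\<bar>t - s\<bar> powr h / c) ^ (2 * m) \<le> (1/4) ^ n" .
    have "prob {\<omega>\<in>space M. \<bar>X t \<omega> - X s \<omega>\<bar> \<ge> c} \<le> K * (\<bar>t - s\<bar> powr h / c) ^ (2 * m)"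
      using K st c by blast
    also have "\<dots> \<le> \<bar>K\<bar> * (1/4) ^ n"
      using * c by (intro mult_mono) auto
    finally show "prob {\<omega>\<in>space M. \<bar>X t \<omega> - X s \<omega>\<bar> \<ge> 2 powr (- \<gamma> * real n)} \<le> \<bar>K\<bar> * (1/4) ^ n"
      by (simp add: c_def)
  qed simp
qed

text \<open>By the union bound some increment of level \<open>n\<close> reaches the threshold with
  probability of order \<open>2 ^ n * (1/4) ^ n = (1/2) ^ n\<close>, which is summable. Almost
  surely only finitely many levels are exceptional, and a path-dependent constant absorbs
  them.\<close>

lemma (in prob_space) AE_dyadic_increments_le:
  fixes X :: "real \<Rightarrow> 'a \<Rightarrow> real"
  assumes meas: "\<And>t. t \<in> {0..1} \<Longrightarrow> X t \<in> borel_measurable M"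
    and tail: "\<And>m. \<exists>K. \<forall>s\<in>{0..1}. \<forall>t\<in>{0..1}. \<forall>c>0.
      prob {\<omega>\<in>space M. \<bar>X t \<omega> - X s \<omega>\<bar> \<ge> c} \<le> K * (\<bar>t - s\<bar> powr h / c) ^ (2 * m)"
    and \<gamma>: "\<gamma> < h" and h: "0 < h"
  shows "AE \<omega> in M. \<exists>K\<ge>0. \<forall>n. \<forall>k<2 ^ n.
      \<bar>X ((real k + 1) / 2 ^ n) \<omega> - X (real k / 2 ^ n) \<omega>\<bar> \<le> K * 2 powr (- \<gamma> * real n)"
proof -
  obtain K where K: "K \<ge> 0" "\<And>n s t. s \<in> {0..1} \<Longrightarrow> t \<in> {0..1} \<Longrightarrow> \<bar>t - s\<bar> \<le> 1 / 2 ^ n \<Longrightarrow>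
      prob {\<omega>\<in>space M. \<bar>X t \<omega> - X s \<omega>\<bar> \<ge> 2 powr (- \<gamma> * real n)} \<le> K * (1/4) ^ n"
    using tail_dyadic_le[OF tail \<gamma> h] by blast
  have mem: "real k / 2 ^ n \<in> {0..1}" "(real k + 1) / 2 ^ n \<in> {0..1}" if "k < 2 ^ n" for k n
  proof -
    have "real (Suc k) \<le> real (2 ^ n)" using that unfolding of_nat_le_iff by simp
    then have "real k + 1 \<le> 2 ^ n" by simp
    then show "real k / 2 ^ n \<in> {0..1}" "(real k + 1) / 2 ^ n \<in> {0..1}" using that by (auto simp: divide_simps)
  qed
  define B where "B n k = {\<omega>\<in>space M. \<bar>X ((real k + 1) / 2 ^ n) \<omega> - X (real k / 2 ^ n) \<omega>\<bar> \<ge> 2 powr (- \<gamma> * real n)}" for n k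
  define A where "A n = (\<Union>k<2 ^ n. B n k)" for n
  have B: "B n k \<in> events" if "k < 2 ^ n" for n k
  proof -
    note [measurable] = meas[OF mem(1)[OF that]] meas[OF mem(2)[OF that]]
    show ?thesis unfolding B_def by measurable
  qed
  have "prob (A n) \<le> K * (1/2) ^ n" for n
  proof -
    have "prob (A n) \<le> (\<Sum>k<2 ^ n. prob (B n k))"
      unfolding A_def using B by (intro measure_UNION_le) auto
    also have "\<dots> \<le> (\<Sum>k<2 ^ n :: nat. K * (1/4) ^ n)"
    proof (intro sum_mono)
      fix k :: nat assume "k \<in> {..<2 ^ n}"
      then show "prob (B n k) \<le> K * (1/4) ^ n"
        unfolding B_def using mem[of k n] by (intro K(2)) (auto simp: diff_divide_distrib[symmetric])
    qed
    also have "\<dots> = K * (2 * (1/4)) ^ n" unfolding power_mult_distrib by simp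
    also have "(2 * (1/4)) = (1/2 :: real)" by simp
    finally show ?thesis .
  qed
  moreover have "A n \<in> events" for n unfolding A_def using B by auto
  ultimately have "AE \<omega> in M. eventually (\<lambda>n. \<omega> \<notin> A n) sequentially"
    by (rule AE_eventually_notin_of_geometric[rotated])
  then show ?thesis
  proof (rule AE_mp, intro AE_I2 impI)
    fix \<omega> assume \<omega>: "\<omega> \<in> space M" "eventually (\<lambda>n. \<omega> \<notin> A n) sequentially"
    then obtain N where N: "\<And>n. n \<ge> N \<Longrightarrow> \<omega> \<notin> A n" by (auto simp: eventually_sequentially)
    define d where "d n k = \<bar>X ((real k + 1) / 2 ^ n) \<omega> - X (real k / 2 ^ n) \<omega>\<bar>" for n k
    \<comment> \<open>The \<open>1\<close> covers the levels from \<open>N\<close> on; the double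
      sum of nonnegative terms dominates every normalised increment below \<open>N\<close>.\<close>
    define L where "L = 1 + (\<Sum>n<N. \<Sum>k<2 ^ n. d n k / 2 powr (- \<gamma> * real n))"
    have d: "0 \<le> d n k" for n k by (simp add: d_def)
    have L: "1 \<le> L" unfolding L_def using d by (simp add: sum_nonneg)
    have "d n k \<le> L * 2 powr (- \<gamma> * real n)" if k: "k < 2 ^ n" for n k
    proof (cases "n \<ge> N")
      case True
      then have "d n k \<le> 1 * 2 powr (- \<gamma> * real n)" using N[OF True] k \<omega> by (force simp: A_def B_def d_def)
      also have "\<dots> \<le> L * 2 powr (- \<gamma> * real n)" using L by (intro mult_right_mono) auto
      finally show ?thesis .
    next
      case False
      have "d n k / 2 powr (- \<gamma> * real n) \<le> (\<Sum>k<2 ^ n. d n k / 2 powr (- \<gamma> * real n))"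
        using k d by (intro member_le_sum) auto
      also have "\<dots> \<le> (\<Sum>n<N. \<Sum>k<2 ^ n. d n k / 2 powr (- \<gamma> * real n))"
        using False d by (intro member_le_sum[of n "{..<N}" "\<lambda>n. \<Sum>k<2 ^ n. d n k / 2 powr (- \<gamma> * real n)"] sum_nonneg) auto
      also have "\<dots> \<le> L" by (simp add: L_def)
      finally show ?thesis by (simp add: pos_divide_le_eq)
    qed
    then show "\<exists>K\<ge>0. \<forall>n. \<forall>k<2 ^ n.
      \<bar>X ((real k + 1) / 2 ^ n) \<omega> - X (real k / 2 ^ n) \<omega>\<bar> \<le> K * 2 powr (- \<gamma> * real n)"
      unfolding d_def using L by (intro exI[of _ L]) auto
  qed
qed

section \<open>Construction of the modification\<close>

lemma holder_on_antimono:
  assumes "holder_on \<gamma>' {0..1} f" "\<gamma> \<le> \<gamma>'"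
  shows "holder_on \<gamma> {0..1} f"
proof -
  obtain C where C: "\<And>s t. s \<in> {0..1} \<Longrightarrow> t \<in> {0..1} \<Longrightarrow> \<bar>f t - f s\<bar> \<le> C * \<bar>t - s\<bar> powr \<gamma>'"
    using assms(1) unfolding holder_on_def by blast
  have "\<bar>f t - f s\<bar> \<le> \<bar>C\<bar> * \<bar>t - s\<bar> powr \<gamma>" if "s \<in> {0..1}" "t \<in> {0..1}" for s t
  proof -
    have "\<bar>f t - f s\<bar> \<le> C * \<bar>t - s\<bar> powr \<gamma>'" using C that by blast
    also have "\<dots> \<le> \<bar>C\<bar> * \<bar>t - s\<bar> powr \<gamma>"
      using that assms by (intro mult_mono powr_mono') auto
    finally show ?thesis .
  qed
  then show ?thesis unfolding holder_on_def by blast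
qed

text \<open>\<open>Y\<close> is the limit of \<open>X\<close> along dyadic floors outside a single
  null set; countably many exponents increasing to \<open>h\<close> keep that set independent of
  \<open>\<gamma>\<close>. For fixed \<open>t\<close>, Borel-Cantelli shows that the same values
  converge almost surely to \<open>X t\<close>, which identifies the two limits.\<close>

theorem (in prob_space) kolmogorov_chentsov_modification:
  fixes X :: "real \<Rightarrow> 'a \<Rightarrow> real"
  assumes meas: "\<And>t. t \<in> {0..1} \<Longrightarrow> X t \<in> borel_measurable M"
    and tail: "\<And>m. \<exists>K. \<forall>s\<in>{0..1}. \<forall>t\<in>{0..1}. \<forall>c>0.
      prob {\<omega>\<in>space M. \<bar>X t \<omega> - X s \<omega>\<bar> \<ge> c} \<le> K * (\<bar>t - s\<bar> powr h / c) ^ (2 * m)"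
    and h: "0 < h"
  shows "\<exists>Y. modification_on {0..1} M X Y \<and>
    (\<forall>\<omega>\<in>space M. \<forall>\<gamma>. 0 < \<gamma> \<and> \<gamma> < h \<longrightarrow> holder_on \<gamma> {0..1} (\<lambda>t. Y t \<omega>))"
proof -
  define good where "good \<gamma> \<omega> \<longleftrightarrow> (\<exists>K\<ge>0. \<forall>n. \<forall>k<2 ^ n.
      \<bar>X ((real k + 1) / 2 ^ n) \<omega> - X (real k / 2 ^ n) \<omega>\<bar> \<le> K * 2 powr (- \<gamma> * real n))" for \<gamma> \<omega>
  \<comment> \<open>The offset \<open>2\<close> makes already \<open>g 0 = h / 2\<close>
    positive.\<close>
  define g where "g i = h - h / real (i + 2)" for i :: nat
  have g: "0 < g i" "g i < h" for i using h by (auto simp: g_def field_simps add_pos_nonneg)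
  have "AE \<omega> in M. \<forall>i. good (g i) \<omega>"
    unfolding AE_all_countable good_def
    by (intro allI AE_dyadic_increments_le[where h = h] meas tail g h)
  then obtain N where N: "\<And>\<omega> i. \<omega> \<in> space M - N \<Longrightarrow> good (g i) \<omega>" "N \<in> null_sets M"
    by (rule AE_E3) blast
  \<comment> \<open>The value \<open>0\<close> on \<open>N\<close> makes every path Hoelder
    continuous, not merely almost every one.\<close>
  define Y where "Y t \<omega> = (if \<omega> \<in> N then 0 else lim (\<lambda>n. X (dyadic_floor n t) \<omega>))" for t \<omega>
  have hol: "holder_on (g i) {0..1} (\<lambda>t. Y t \<omega>)" and conv: "t \<in> {0..1} \<Longrightarrow> (\<lambda>n. X (dyadic_floor n t) \<omega>) \<longlonglongrightarrow> Y t \<omega>"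
    if \<omega>: "\<omega> \<in> space M - N" for \<omega> i t
  proof -
    have *: "good (g i) \<omega>" for i using N(1)[OF \<omega>] .
    obtain K where K: "K \<ge> 0" "\<And>n k. k < 2 ^ n \<Longrightarrow>
      \<bar>X ((real k + 1) / 2 ^ n) \<omega> - X (real k / 2 ^ n) \<omega>\<bar> \<le> K * 2 powr (- g i * real n)"
      using *[of i] unfolding good_def by blast
    have "holder_on (g i) {0..1} (\<lambda>t. lim (\<lambda>n. X (dyadic_floor n t) \<omega>))"
      by (rule holder_on_dyadic_limit(2)[of "g i" K "\<lambda>t. X t \<omega>"]) (use g K in auto)
    then show "holder_on (g i) {0..1} (\<lambda>t. Y t \<omega>)" using \<omega> by (simp add: Y_def)
    assume t: "t \<in> {0..1}"
    have "convergent (\<lambda>n. X (dyadic_floor n t) \<omega>)"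
      by (rule holder_on_dyadic_limit(1)[of "g i" K "\<lambda>t. X t \<omega>"]) (use g K t in auto)
    then show "(\<lambda>n. X (dyadic_floor n t) \<omega>) \<longlonglongrightarrow> Y t \<omega>"
      using \<omega> by (simp add: Y_def convergent_LIMSEQ_iff)
  qed
  have "holder_on \<gamma> {0..1} (\<lambda>t. Y t \<omega>)" if \<omega>: "\<omega> \<in> space M" and \<gamma>: "0 < \<gamma>" "\<gamma> < h" for \<omega> \<gamma>
  proof (cases "\<omega> \<in> N")
    case True
    then show ?thesis by (auto simp: Y_def holder_on_def intro!: exI[of _ 0])
  next
    case False
    \<comment> \<open>The condition \<open>i + 2 \<ge> h / (h - \<gamma>)\<close> amounts to
      \<open>\<gamma> \<le> g i\<close>.\<close>
    obtain i where "h / (h - \<gamma>) \<le> real i" using real_arch_simple by blast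
    then have "h / (h - \<gamma>) \<le> real (i + 2)" by simp
    then have "\<gamma> \<le> g i" using \<gamma> by (simp add: g_def field_simps)
    then show ?thesis using hol[of \<omega> i] False \<omega> by (blast intro: holder_on_antimono)
  qed
  moreover have "modification_on {0..1} M X Y"
    unfolding modification_on_def
  proof (intro ballI conjI)
    fix t :: real assume t: "t \<in> {0..1}"
    have [measurable]: "X (dyadic_floor n t) \<in> borel_measurable M" for n
      using meas dyadic_floor_mem[OF t] by blast
    have [measurable]: "N \<in> sets M" "X t \<in> borel_measurable M" using N(2) meas t by auto
    show "Y t \<in> borel_measurable M" unfolding Y_def[abs_def] by measurable
    \<comment> \<open>Any positive exponent below \<open>h\<close> yields convergence at the fixed
      point \<open>t\<close>; \<open>g 0\<close> is taken.\<close>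
    obtain K where K: "\<And>n s u. s \<in> {0..1} \<Longrightarrow> u \<in> {0..1} \<Longrightarrow> \<bar>u - s\<bar> \<le> 1 / 2 ^ n \<Longrightarrow>
      prob {\<omega>\<in>space M. \<bar>X u \<omega> - X s \<omega>\<bar> \<ge> 2 powr (- g 0 * real n)} \<le> K * (1/4) ^ n" "K \<ge> 0"
      using tail_dyadic_le[OF tail g(2) h] by blast
    let ?A = "\<lambda>n. {\<omega>\<in>space M. \<bar>X t \<omega> - X (dyadic_floor n t) \<omega>\<bar> \<ge> 2 powr (- g 0 * real n)}"
    have "AE \<omega> in M. eventually (\<lambda>n. \<omega> \<notin> ?A n) sequentially"
    proof (rule AE_eventually_notin_of_geometric)
      fix n
      have "prob (?A n) \<le> K * (1/4) ^ n"
        by (intro K(1) t dyadic_floor_mem dyadic_floor_dist)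
      also have "\<dots> \<le> K * (1/2) ^ n" using K(2) by (intro mult_left_mono power_mono) auto
      finally show "prob (?A n) \<le> K * (1/2) ^ n" .
    qed measurable
    moreover have "AE \<omega> in M. \<omega> \<notin> N" using N(2) by (rule AE_not_in)
    ultimately show "AE \<omega> in M. Y t \<omega> = X t \<omega>"
      using AE_space
    proof eventually_elim
      case (elim \<omega>)
      have "((\<lambda>n. (1 / 2 powr g 0) ^ n) \<longlonglongrightarrow> 0)"
        using g[of 0] by (intro LIMSEQ_power_zero) simp
      also have "(\<lambda>n. (1 / 2 powr g 0) ^ n) = (\<lambda>n. 2 powr (- g 0 * real n))"
        by (simp add: powr_minus_divide power_one_over powr_powr flip: powr_realpow)
      finally have "(\<lambda>n. X (dyadic_floor n t) \<omega> - X t \<omega>) \<longlonglongrightarrow> 0"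
        by (rule Lim_null_comparison[rotated])
          (use elim in \<open>auto elim!: eventually_mono simp: abs_minus_commute\<close>)
      then have "(\<lambda>n. X (dyadic_floor n t) \<omega>) \<longlonglongrightarrow> X t \<omega>" by (simp add: LIM_zero_iff)
      moreover have "(\<lambda>n. X (dyadic_floor n t) \<omega>) \<longlonglongrightarrow> Y t \<omega>" using conv t elim by simp
      ultimately show ?case by (rule LIMSEQ_unique[rotated])
    qed
  qed
  ultimately show ?thesis by blast
qed

section \<open>Regularity of the process\<close>

theorem theorem3p2:
  fixes M :: "'a measure"
    and H :: "nat \<Rightarrow> real \<Rightarrow> real"
    and Hlow Hup C0 :: real
    and \<epsilon> :: "nat \<Rightarrow> nat \<Rightarrow> 'a \<Rightarrow> real"
    and X :: "real \<Rightarrow> 'a \<Rightarrow> real"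
  assumes "prob_space M"
    and "0 < Hlow" and "Hlow \<le> Hup" and "Hup < 1"
    and "\<And>j x. x \<in> {0..1} \<Longrightarrow> H j x \<in> {Hlow..Hup}"
    and "\<And>j. \<exists>L. L-lipschitz_on {0..1} (H j)"
    and "C0 > 0"
    and "\<And>j. lipschitz_norm01 (H j) \<le> C0 * (1 + real j)"
    and "standard_gaussian_family M \<epsilon>"
    and "GHBMP M H \<epsilon> X"
  shows "(\<exists>c>0. \<forall>t'\<in>{0..1}. \<forall>t''\<in>{0..1}.
            prob_space.expectation M (\<lambda>\<omega>. \<bar>X t'' \<omega> - X t' \<omega>\<bar>\<^sup>2) \<le> c * \<bar>t'' - t'\<bar> powr (2 * Hlow)) \<and>
         (\<exists>Y. modification_on {0..1} M X Y \<and>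
            (\<forall>\<omega>\<in>space M. \<forall>\<gamma>. 0 < \<gamma> \<and> \<gamma> < Hlow \<longrightarrow> holder_on \<gamma> {0..1} (\<lambda>t. Y t \<omega>)))"
proof -
  interpret prob_space M by fact
  note Hb = assms(2,4)
  have tendsto: "tendsto_L2 M (\<lambda>J. ghbmp_partial_sum H \<epsilon> J t) (X t)" if "t \<in> {0..1}" for t
    using assms(10) that by (simp add: GHBMP_def)
  obtain c where c: "c > 0" "\<And>J t' t''. t' \<in> {0..1} \<Longrightarrow> t'' \<in> {0..1} \<Longrightarrow>
      (\<Sum>j<J. \<Sum>k<2^j. (ghbmp_coeff H t'' j k - ghbmp_coeff H t' j k)\<^sup>2) \<le> c * \<bar>t'' - t'\<bar> powr (2 * Hlow)"
    using increment_variance_le[of H Hlow Hup, OF assms(5) Hb] by blast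
  \<comment> \<open>The moment formula is monotone in the variance, so the bound is uniform in
    \<open>J\<close>, as the passage to the limit requires.\<close>
  have moment: "integrable M (\<lambda>\<omega>. (ghbmp_partial_sum H \<epsilon> J t'' \<omega> - ghbmp_partial_sum H \<epsilon> J t' \<omega>) ^ (2 * m))"
    "expectation (\<lambda>\<omega>. (ghbmp_partial_sum H \<epsilon> J t'' \<omega> - ghbmp_partial_sum H \<epsilon> J t' \<omega>) ^ (2 * m))
      \<le> fact (2 * m) / (2 ^ m * fact m) * (c * \<bar>t'' - t'\<bar> powr (2 * Hlow)) ^ m"
    if "t' \<in> {0..1}" "t'' \<in> {0..1}" for J m t' t''
  proof -
    note mom = ghbmp_partial_sum_increment_moment[OF assms(9), of H J t'' t' m]
    show "integrable M (\<lambda>\<omega>. (ghbmp_partial_sum H \<epsilon> J t'' \<omega> - ghbmp_partial_sum H \<epsilon> J t' \<omega>) ^ (2 * m))"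
      using mom by (rule integrable.intros)
    show "expectation (\<lambda>\<omega>. (ghbmp_partial_sum H \<epsilon> J t'' \<omega> - ghbmp_partial_sum H \<epsilon> J t' \<omega>) ^ (2 * m))
      \<le> fact (2 * m) / (2 ^ m * fact m) * (c * \<bar>t'' - t'\<bar> powr (2 * Hlow)) ^ m"
      unfolding has_bochner_integral_integral_eq[OF mom]
      by (intro mult_left_mono power_mono c(2) that sum_nonneg) auto
  qed
  have "expectation (\<lambda>\<omega>. \<bar>X t'' \<omega> - X t' \<omega>\<bar>\<^sup>2) \<le> (3 * c) * \<bar>t'' - t'\<bar> powr (2 * Hlow)"
    if t: "t' \<in> {0..1}" "t'' \<in> {0..1}" for t' t''
  proof -
    \<comment> \<open>For \<open>m = 1\<close> the factor
      \<open>fact (2 * m) / (2 ^ m * fact m)\<close> equals \<open>1\<close>.\<close>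
    have "expectation (\<lambda>\<omega>. (X t'' \<omega> - X t' \<omega>)\<^sup>2) \<le> 3 * (c * \<bar>t'' - t'\<bar> powr (2 * Hlow))"
      using moment(2)[of t' t'' _ 1] t
      by (intro tendsto_L2_second_moment_le[OF tendsto tendsto] t) (simp add: fact_numeral)
    then show ?thesis by simp
  qed
  then have second_moment: "\<exists>c>0. \<forall>t'\<in>{0..1}. \<forall>t''\<in>{0..1}.
      expectation (\<lambda>\<omega>. \<bar>X t'' \<omega> - X t' \<omega>\<bar>\<^sup>2) \<le> c * \<bar>t'' - t'\<bar> powr (2 * Hlow)"
    using c(1) by (intro exI[of _ "3 * c"]) auto
  have "\<exists>K. \<forall>s\<in>{0..1}. \<forall>t\<in>{0..1}. \<forall>l>0.
      prob {\<omega>\<in>space M. \<bar>X t \<omega> - X s \<omega>\<bar> \<ge> l} \<le> K * (\<bar>t - s\<bar> powr Hlow / l) ^ (2 * m)" for m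
  proof (intro exI ballI allI impI)
    fix s t l :: real assume st: "s \<in> {0..1}" "t \<in> {0..1}" and l: "0 < l"
    have "prob {\<omega>\<in>space M. \<bar>X t \<omega> - X s \<omega>\<bar> \<ge> l} \<le>
        fact (2 * m) / (2 ^ m * fact m) * (c * \<bar>t - s\<bar> powr (2 * Hlow)) ^ m / (l / 2) ^ (2 * m)"
      by (intro tendsto_L2_tail_le[OF tendsto tendsto] st moment l)
    also have "\<bar>t - s\<bar> powr (2 * Hlow) = (\<bar>t - s\<bar> powr Hlow)\<^sup>2"
      by (simp add: power2_eq_square flip: powr_add)
    \<comment> \<open>The halved threshold accounts for \<open>2 ^ (2 * m)\<close>. The constant so
      collected depends on \<open>m\<close> and \<open>c\<close> only, as the quantifier order
      demands.\<close>
    also have "fact (2 * m) / (2 ^ m * fact m) * (c * (\<bar>t - s\<bar> powr Hlow)\<^sup>2) ^ m / (l / 2) ^ (2 * m) =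
      (fact (2 * m) / (2 ^ m * fact m) * c ^ m * 2 ^ (2 * m)) * (\<bar>t - s\<bar> powr Hlow / l) ^ (2 * m)"
      by (simp add: power_mult_distrib power_divide power_mult)
    finally show "prob {\<omega>\<in>space M. \<bar>X t \<omega> - X s \<omega>\<bar> \<ge> l} \<le>
      (fact (2 * m) / (2 ^ m * fact m) * c ^ m * 2 ^ (2 * m)) * (\<bar>t - s\<bar> powr Hlow / l) ^ (2 * m)" .
  qed
  moreover have "X t \<in> borel_measurable M" if "t \<in> {0..1}" for t
    using tendsto[OF that] by (simp add: tendsto_L2_def square_integrable_def)
  ultimately have "\<exists>Y. modification_on {0..1} M X Y \<and>
      (\<forall>\<omega>\<in>space M. \<forall>\<gamma>. 0 < \<gamma> \<and> \<gamma> < Hlow \<longrightarrow> holder_on \<gamma> {0..1} (\<lambda>t. Y t \<omega>))"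
    using assms(2) by (intro kolmogorov_chentsov_modification)
  with second_moment show ?thesis by blast
qed

end
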